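(* Let $X(u,v)$ be a non-planar minimal surface with planar curvature lines in $\mathbb{R}^3$. Then, up to isometries and homotheties of $\mathbb{R}^3$ (and up to translation, reflection and rescaling of the isothermic parameters $(u,v)$), $X$ must have on its domain the parametrization $X^\theta(u,v)$ for some $\theta\in\left(-\frac{\pi}{4},\frac{3\pi}{4}\right)$, where for $\theta\neq\frac{\pi}{4}$, writing $k=\sqrt{\cos2\theta}$, $$X^\theta(u,v)=\left(\frac{k u\cos\theta-\sin\theta\,\sinh(ku)\cos(kv)}{k^3},\ \frac{k v\sin\theta-\cos\theta\,\cosh(ku)\sin(kv)}{k^3},\ \frac{\cosh(ku)\cos(kv)-1}{k^2}\right),$$ and for $\theta=\frac{\pi}{4}$, $$X^\theta(u,v)=\left(-\frac{u(-6+u^2-3v^2)}{6\sqrt2},\ \frac{v(-6-3u^2+v^2)}{6\sqrt2},\ \frac{u^2-v^2}{2}\right).$$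
   Context: Surfaces are conformal immersions $X:\Sigma\to\mathbb{R}^3$ of simply-connected domains $\Sigma\subset\mathbb{R}^2$ with unit normal $N$; minimal means mean curvature zero. Non-planar surfaces are taken umbilic-free, and $(u,v)$ are isothermic coordinates, i.e. conformal curvature line coordinates, normalized so that the Hopf differential factor $Q=\frac14\langle X_{uu}-2iX_{uv}-X_{vv},N\rangle$ equals $-\frac12$. Planar curvature lines means each curvature line lies in some plane. When $\cos2\theta<0$, $k$ is purely imaginary and the formulas are read with the same choice of $k$ throughout; they give real values. *)

theory Defs
  imports "HOL-Analysis.Analysis"
begin

fun higher_differentiable_on ::
  "'a::real_normed_vector set \<Rightarrow> ('a \<Rightarrow> 'b::real_normed_vector) \<Rightarrow> nat \<Rightarrow> bool" where
  "higher_differentiable_on S f 0 \<longleftrightarrow> continuous_on S f"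
| "higher_differentiable_on S f (Suc n) \<longleftrightarrow>
     (\<forall>x\<in>S. f differentiable (at x)) \<and>
     (\<forall>w. higher_differentiable_on S (\<lambda>x. frechet_derivative f (at x) w) n)"

text \<open>Only used for open \<open>S\<close>.\<close>

definition smooth_on ::
  "'a::real_normed_vector set \<Rightarrow> ('a \<Rightarrow> 'b::real_normed_vector) \<Rightarrow> bool" where
  "smooth_on S f \<longleftrightarrow> (\<forall>n. higher_differentiable_on S f n)"

definition diff_u :: "(real \<times> real \<Rightarrow> real^3) \<Rightarrow> real \<times> real \<Rightarrow> real^3" where
  "diff_u X p = frechet_derivative X (at p) (1, 0)"

definition diff_v :: "(real \<times> real \<Rightarrow> real^3) \<Rightarrow> real \<times> real \<Rightarrow> real^3" where
  "diff_v X p = frechet_derivative X (at p) (0, 1)"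

definition conformal_immersion_on :: "(real \<times> real) set \<Rightarrow> (real \<times> real \<Rightarrow> real^3) \<Rightarrow> bool" where
  "conformal_immersion_on U X \<longleftrightarrow>
     smooth_on U X \<and>
     (\<forall>p\<in>U. inj (frechet_derivative X (at p)) \<and>
            diff_u X p \<bullet> diff_u X p = diff_v X p \<bullet> diff_v X p \<and>
            diff_u X p \<bullet> diff_v X p = 0)"

text \<open>Either of the two choices of sign of the unit normal is allowed.\<close>

definition unit_normal_on ::
  "(real \<times> real) set \<Rightarrow> (real \<times> real \<Rightarrow> real^3) \<Rightarrow> (real \<times> real \<Rightarrow> real^3) \<Rightarrow> bool" where
  "unit_normal_on U X N \<longleftrightarrow>
     smooth_on U N \<and>
     (\<forall>p\<in>U. norm (N p) = 1 \<and> N p \<bullet> diff_u X p = 0 \<and> N p \<bullet> diff_v X p = 0)"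

definition mean_curvature ::
  "(real \<times> real \<Rightarrow> real^3) \<Rightarrow> (real \<times> real \<Rightarrow> real^3) \<Rightarrow> real \<times> real \<Rightarrow> real" where
  "mean_curvature X N p =
    (let E = diff_u X p \<bullet> diff_u X p;
         F = diff_u X p \<bullet> diff_v X p;
         G = diff_v X p \<bullet> diff_v X p;
         l = diff_u (diff_u X) p \<bullet> N p;
         m = diff_v (diff_u X) p \<bullet> N p;
         n = diff_v (diff_v X) p \<bullet> N p
     in (E * n - 2 * F * m + G * l) / (2 * (E * G - F\<^sup>2)))"

definition minimal_on ::
  "(real \<times> real) set \<Rightarrow> (real \<times> real \<Rightarrow> real^3) \<Rightarrow> (real \<times> real \<Rightarrow> real^3) \<Rightarrow> bool" where
  "minimal_on U X N \<longleftrightarrow> (\<forall>p\<in>U. mean_curvature X N p = 0)"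

text \<open>The inner product is extended complex-bilinearly in the Hopf differential factor.\<close>

definition hopf_factor ::
  "(real \<times> real \<Rightarrow> real^3) \<Rightarrow> (real \<times> real \<Rightarrow> real^3) \<Rightarrow> real \<times> real \<Rightarrow> complex" where
  "hopf_factor X N p =
     (complex_of_real (diff_u (diff_u X) p \<bullet> N p)
      - 2 * \<i> * complex_of_real (diff_v (diff_u X) p \<bullet> N p)
      - complex_of_real (diff_v (diff_v X) p \<bullet> N p)) / 4"

definition principal_direction ::
  "(real \<times> real \<Rightarrow> real^3) \<Rightarrow> (real \<times> real \<Rightarrow> real^3) \<Rightarrow> real \<times> real \<Rightarrow> real \<times> real \<Rightarrow> bool" where
  "principal_direction X N p w \<longleftrightarrow>
     w \<noteq> 0 \<and> (\<exists>\<kappa>. frechet_derivative N (at p) w = - \<kappa> *\<^sub>R frechet_derivative X (at p) w)"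

definition umbilic ::
  "(real \<times> real \<Rightarrow> real^3) \<Rightarrow> (real \<times> real \<Rightarrow> real^3) \<Rightarrow> real \<times> real \<Rightarrow> bool" where
  "umbilic X N p \<longleftrightarrow>
     (\<exists>\<kappa>. \<forall>w. frechet_derivative N (at p) w = - \<kappa> *\<^sub>R frechet_derivative X (at p) w)"

definition curvature_line_coordinates_on ::
  "(real \<times> real) set \<Rightarrow> (real \<times> real \<Rightarrow> real^3) \<Rightarrow> (real \<times> real \<Rightarrow> real^3) \<Rightarrow> bool" where
  "curvature_line_coordinates_on U X N \<longleftrightarrow>
     (\<forall>p\<in>U. principal_direction X N p (1, 0) \<and> principal_direction X N p (0, 1))"

text \<open>A curvature line is given by its preimage \<open>\<gamma>\<close> in the parameter domain.
  The principal-direction condition includes regularity of \<open>\<gamma>\<close>.\<close>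

definition curvature_line_on ::
  "(real \<times> real) set \<Rightarrow> (real \<times> real \<Rightarrow> real^3) \<Rightarrow> (real \<times> real \<Rightarrow> real^3) \<Rightarrow>
   real set \<Rightarrow> (real \<Rightarrow> real \<times> real) \<Rightarrow> bool" where
  "curvature_line_on U X N I \<gamma> \<longleftrightarrow>
     open I \<and> is_interval I \<and> \<gamma> C1_differentiable_on I \<and> \<gamma> ` I \<subseteq> U \<and>
     (\<forall>t\<in>I. principal_direction X N (\<gamma> t) (vector_derivative \<gamma> (at t)))"

definition in_some_plane :: "(real^3) set \<Rightarrow> bool" where
  "in_some_plane S \<longleftrightarrow> (\<exists>a b. a \<noteq> 0 \<and> S \<subseteq> {x. a \<bullet> x = b})"

definition planar_curvature_lines_on ::
  "(real \<times> real) set \<Rightarrow> (real \<times> real \<Rightarrow> real^3) \<Rightarrow> (real \<times> real \<Rightarrow> real^3) \<Rightarrow> bool" where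
  "planar_curvature_lines_on U X N \<longleftrightarrow>
     (\<forall>I \<gamma>. curvature_line_on U X N I \<gamma> \<longrightarrow> in_some_plane ((X \<circ> \<gamma>) ` I))"

definition model_k :: "real \<Rightarrow> complex" where
  "model_k \<theta> = csqrt (complex_of_real (cos (2 * \<theta>)))"

definition model_1 :: "real \<Rightarrow> real \<Rightarrow> real \<Rightarrow> complex" where
  "model_1 \<theta> u v = (let k = model_k \<theta> in
     (k * of_real u * of_real (cos \<theta>)
      - of_real (sin \<theta>) * sinh (k * of_real u) * cos (k * of_real v)) / k ^ 3)"

definition model_2 :: "real \<Rightarrow> real \<Rightarrow> real \<Rightarrow> complex" where
  "model_2 \<theta> u v = (let k = model_k \<theta> in
     (k * of_real v * of_real (sin \<theta>)
      - of_real (cos \<theta>) * cosh (k * of_real u) * sin (k * of_real v)) / k ^ 3)"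

definition model_3 :: "real \<Rightarrow> real \<Rightarrow> real \<Rightarrow> complex" where
  "model_3 \<theta> u v = (let k = model_k \<theta> in
     (cosh (k * of_real u) * cos (k * of_real v) - 1) / k ^ 2)"

text \<open>The number \<open>model_k \<theta>\<close> is purely imaginary when \<open>cos (2 * \<theta>) < 0\<close>; the three
  coordinates are real nevertheless, so taking real parts below loses nothing.\<close>

lemma cnj_model_k: "cnj (model_k \<theta>) = model_k \<theta> \<or> cnj (model_k \<theta>) = - model_k \<theta>"
proof (cases "cos (2 * \<theta>) \<ge> 0")
  case True
  then show ?thesis by (simp add: model_k_def csqrt_of_real_nonneg)
next
  case False
  then show ?thesis by (simp add: model_k_def csqrt_of_real_nonpos)
qed

lemma model_real: "model_1 \<theta> u v \<in> \<real>" "model_2 \<theta> u v \<in> \<real>" "model_3 \<theta> u v \<in> \<real>"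
proof -
  have sh: "cnj (sinh z) = sinh (cnj z)" and ch: "cnj (cosh z) = cosh (cnj z)" for z
    by (simp_all add: sinh_field_def cosh_field_def exp_cnj)
  show "model_1 \<theta> u v \<in> \<real>" "model_2 \<theta> u v \<in> \<real>" "model_3 \<theta> u v \<in> \<real>"
    using cnj_model_k[of \<theta>]
    by (auto simp: model_1_def model_2_def model_3_def Let_def Reals_cnj_iff sh ch
        cnj_sin cnj_cos minus_divide_left power3_eq_cube power2_eq_square)
qed

definition model_surface :: "real \<Rightarrow> real \<times> real \<Rightarrow> real^3" where
  "model_surface \<theta> = (\<lambda>(u, v).
     if \<theta> = pi / 4 then
       vector [- (u * (- 6 + u\<^sup>2 - 3 * v\<^sup>2) / (6 * sqrt 2)),
               v * (- 6 - 3 * u\<^sup>2 + v\<^sup>2) / (6 * sqrt 2),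
               (u\<^sup>2 - v\<^sup>2) / 2]
     else
       vector [Re (model_1 \<theta> u v), Re (model_2 \<theta> u v), Re (model_3 \<theta> u v)])"

definition isometry_of_space :: "(real^3 \<Rightarrow> real^3) \<Rightarrow> bool" where
  "isometry_of_space T \<longleftrightarrow> (\<forall>x y. dist (T x) (T y) = dist x y)"

text \<open>Translations, reflections in the coordinate axes and uniform rescalings: these are the
  affine changes of parameters that keep \<open>(u, v)\<close> conformal and preserve each of the two
  families of coordinate lines.\<close>

definition isothermic_reparametrization :: "(real \<times> real \<Rightarrow> real \<times> real) \<Rightarrow> bool" where
  "isothermic_reparametrization \<phi> \<longleftrightarrow>
     (\<exists>\<mu> \<epsilon>\<^sub>1 \<epsilon>\<^sub>2 a b. \<mu> > 0 \<and> \<epsilon>\<^sub>1 \<in> {-1, 1} \<and> \<epsilon>\<^sub>2 \<in> {-1, 1} \<and>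
        \<phi> = (\<lambda>(u, v). (\<mu> * \<epsilon>\<^sub>1 * u + a, \<mu> * \<epsilon>\<^sub>2 * v + b)))"

end

theory Submission
  imports Defs
begin

text \<open>
  Let \<open>\<rho> = |X\<^sub>u| = |X\<^sub>v|\<close>. Vanishing mean curvature and Hopf factor \<open>-1/2\<close> make the second
  fundamental form \<open>-du\<^sup>2 + dv\<^sup>2\<close>. Together with the first fundamental form
  \<open>\<rho>\<^sup>2 (du\<^sup>2 + dv\<^sup>2)\<close> this expresses the derivatives of the frame
  \<open>e = X\<^sub>u / \<rho>\<close>, \<open>f = X\<^sub>v / \<rho>\<close>, \<open>N\<close> through \<open>\<rho>\<close> and its gradient alone, so \<open>\<rho>\<close>
  determines the surface up to congruence: the orthogonal map that carries one adapted frame to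
  another with the same \<open>\<rho>\<close> has zero derivative (\<open>isothermic_frame_rigidity\<close>). It remains to
  find \<open>\<rho>\<close>.

  There are two equations for \<open>\<rho>\<close>. The Gauss equation reads
  \<open>\<rho> (\<rho>\<^sub>u\<^sub>u + \<rho>\<^sub>v\<^sub>v) - \<rho>\<^sub>u\<^sup>2 - \<rho>\<^sub>v\<^sup>2 = 1\<close>. If a \<open>u\<close>-curve lies in a plane with
  normal \<open>a\<close>, then \<open>a\<close> is orthogonal to \<open>X\<^sub>u\<close> and to \<open>X\<^sub>u\<^sub>u\<close> along the curve, and
  differentiating the second orthogonality relation once more yields \<open>\<rho>\<^sub>u\<^sub>v = 0\<close>
  (\<open>mixed_derivative_zero\<close>).

  Differentiating the Gauss equation under \<open>\<rho>\<^sub>u\<^sub>v = 0\<close> shows that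
  \<open>c = (\<rho>\<^sub>u\<^sub>u - \<rho>\<^sub>v\<^sub>v) / \<rho>\<close> has zero gradient, hence is constant on the connected domain.
  Therefore \<open>\<rho>\<close>, \<open>\<rho>\<^sub>u\<close>, \<open>\<rho>\<^sub>v\<close>, \<open>\<rho>\<^sub>u\<^sub>u\<close> satisfy a closed linear system with constant
  coefficients (\<open>exists_profile_system\<close>). Its first integrals are constant
  on a connected domain of any shape, whereas \<open>\<rho>\<^sub>u\<^sub>v = 0\<close> alone splits \<open>\<rho>\<close> into a
  function of \<open>u\<close> and a function of \<open>v\<close> only locally.

  For \<open>c > 0\<close> the solution is \<open>c \<rho> = E cosh(\<kappa>u + a) - D cos(\<kappa>v + b)\<close> with
  \<open>\<kappa>\<^sup>2 = c = E\<^sup>2 - D\<^sup>2\<close>. Up to scaling and translation this is the conformal factor of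
  \<open>X\<^sup>\<theta>\<close> with \<open>tan \<theta> = D / E\<close>, an angle in \<open>[0, \<pi>/4)\<close>. For \<open>c = 0\<close> the solution is
  the quadratic conformal factor of \<open>X\<^sup>\<theta>\<close> with \<open>\<theta> = \<pi>/4\<close>. The case \<open>c < 0\<close> reduces to
  \<open>c > 0\<close> by exchanging \<open>u\<close> and \<open>v\<close> and reversing the normal; on the models this exchange
  replaces \<open>\<theta>\<close> by \<open>\<pi>/2 - \<theta>\<close> (\<open>model_surface_swap\<close>).
\<close>

section \<open>Calculus of smooth maps\<close>

text \<open>The derivative along a fixed vector, as a function of the base point: this is the form in
  which it can be iterated.\<close>

definition pd :: "'a::real_normed_vector \<Rightarrow> ('a \<Rightarrow> 'b::real_normed_vector) \<Rightarrow> 'a \<Rightarrow> 'b" where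
  "pd w f p = frechet_derivative f (at p) w"

lemma pd_eqI: "(f has_derivative f') (at p) \<Longrightarrow> pd w f p = f' w"
  by (simp add: pd_def frechet_derivative_at[symmetric])

lemma pd_cong:
  assumes "open U" "p \<in> U" "f differentiable (at p)" "\<And>x. x \<in> U \<Longrightarrow> f x = g x"
  shows "pd w f p = pd w g p"
  using frechet_derivative_transform_within_open[of f p U g] assms by (simp add: pd_def)

lemma higher_differentiable_on_pd:
  "higher_differentiable_on S f (Suc n) \<longleftrightarrow>
     (\<forall>x\<in>S. f differentiable (at x)) \<and> (\<forall>w. higher_differentiable_on S (pd w f) n)"
  by (simp add: pd_def[abs_def])

declare higher_differentiable_on.simps(2) [simp del]

lemma higher_differentiable_on_cong:
  assumes "open S" "\<And>x. x \<in> S \<Longrightarrow> f x = g x" "higher_differentiable_on S f n"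
  shows "higher_differentiable_on S g n"
  using assms(2,3)
proof (induction n arbitrary: f g)
  case 0
  then show ?case by (simp cong: continuous_on_cong)
next
  case (Suc n)
  have "g differentiable (at x)" if "x \<in> S" for x
    using Suc.prems that assms(1) unfolding higher_differentiable_on_pd
    by (metis differentiable_def has_derivative_transform_within_open)
  moreover have "higher_differentiable_on S (pd w g) n" for w
  proof (rule Suc.IH)
    show "higher_differentiable_on S (pd w f) n"
      using Suc.prems unfolding higher_differentiable_on_pd by blast
    show "pd w f x = pd w g x" if "x \<in> S" for x
      using Suc.prems that assms(1) unfolding higher_differentiable_on_pd by (metis pd_cong)
  qed
  ultimately show ?case unfolding higher_differentiable_on_pd by blast
qed

lemma higher_differentiable_on_Suc_imp:
  assumes "higher_differentiable_on S f (Suc n)"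
  shows "higher_differentiable_on S f n"
  using assms
proof (induction n arbitrary: f)
  case 0
  then show ?case
    by (auto simp: higher_differentiable_on_pd intro!: continuous_at_imp_continuous_on
        differentiable_imp_continuous_within)
next
  case (Suc n)
  then show ?case unfolding higher_differentiable_on_pd[of S f n]
    by (metis higher_differentiable_on_pd)
qed

lemma higher_differentiable_on_add:
  assumes "open S" "higher_differentiable_on S f n" "higher_differentiable_on S g n"
  shows "higher_differentiable_on S (\<lambda>x. f x + g x) n"
  using assms(2,3)
proof (induction n arbitrary: f g)
  case 0
  then show ?case by (simp add: continuous_on_add)
next
  case (Suc n)
  have "pd w f x + pd w g x = pd w (\<lambda>x. f x + g x) x" if "x \<in> S" for w x
    using Suc.prems that unfolding higher_differentiable_on_pd pd_def
    by (intro fun_cong[OF frechet_derivative_at, of _ "\<lambda>w. _ w + _ w"] has_derivative_add)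
       (auto simp: frechet_derivative_works)
  moreover have "higher_differentiable_on S (\<lambda>x. pd w f x + pd w g x) n" for w
    using Suc unfolding higher_differentiable_on_pd by blast
  ultimately have "higher_differentiable_on S (pd w (\<lambda>x. f x + g x)) n" for w
    by (rule higher_differentiable_on_cong[OF assms(1)])
  then show ?case
    using Suc.prems unfolding higher_differentiable_on_pd by (auto intro: differentiable_add)
qed

lemma higher_differentiable_on_bilinear:
  assumes "bounded_bilinear b" "open S"
    "higher_differentiable_on S f n" "higher_differentiable_on S g n"
  shows "higher_differentiable_on S (\<lambda>x. b (f x) (g x)) n"
  using assms(3,4)
proof (induction n arbitrary: f g)
  case 0
  then show ?case by (simp add: bounded_bilinear.continuous_on[OF assms(1)])
next
  case (Suc n)
  have D: "((\<lambda>x. b (f x) (g x)) has_derivative (\<lambda>w. b (f x) (pd w g x) + b (pd w f x) (g x))) (at x)"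
    if "x \<in> S" for x
    using Suc.prems that unfolding higher_differentiable_on_pd pd_def
    by (intro bounded_bilinear.FDERIV[OF assms(1)]) (auto simp: frechet_derivative_works)
  have "higher_differentiable_on S (\<lambda>x. b (f x) (pd w g x) + b (pd w f x) (g x)) n" for w
    using Suc.prems higher_differentiable_on_Suc_imp unfolding higher_differentiable_on_pd[of S _ n]
    by (intro higher_differentiable_on_add assms(2) Suc.IH)
       (auto intro: higher_differentiable_on_Suc_imp simp: higher_differentiable_on_pd[of S _ n])
  moreover have "b (f x) (pd w g x) + b (pd w f x) (g x) = pd w (\<lambda>x. b (f x) (g x)) x"
    if "x \<in> S" for x w
    using pd_eqI[OF D[OF that]] by simp
  ultimately have "higher_differentiable_on S (pd w (\<lambda>x. b (f x) (g x))) n" for w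
    using higher_differentiable_on_cong[OF assms(2), of "\<lambda>x. b (f x) (pd w g x) + b (pd w f x) (g x)"] by blast
  then show ?case
    using D unfolding higher_differentiable_on_pd differentiable_def by blast
qed

lemma higher_differentiable_on_const:
  assumes "open S" shows "higher_differentiable_on S (\<lambda>x. c) n"
proof (induction n arbitrary: c)
  case (Suc n c)
  have "pd w (\<lambda>x. c) = (\<lambda>x. 0)" for w :: 'a by (simp add: pd_def fun_eq_iff)
  then show ?case using Suc by (simp add: higher_differentiable_on_pd)
qed simp

text \<open>The induction needs a general exponent: differentiation lowers it by one. Square roots and
  reciprocals are the cases used below.\<close>

lemma higher_differentiable_on_powr:
  fixes f :: "'a::real_normed_vector \<Rightarrow> real"
  assumes "open S" "higher_differentiable_on S f n" "\<And>x. x \<in> S \<Longrightarrow> f x > 0"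
  shows "higher_differentiable_on S (\<lambda>x. f x powr a) n"
  using assms(2)
proof (induction n arbitrary: a)
  case 0
  then show ?case using assms(3) by (auto intro!: continuous_on_powr simp: less_imp_neq[symmetric] continuous_on_const order.strict_implies_not_eq)
next
  case (Suc n)
  have D: "((\<lambda>x. f x powr a) has_derivative (\<lambda>w. a * (f x powr (a - 1) * pd w f x))) (at x)"
    if "x \<in> S" for x
    using Suc.prems that assms(3)[OF that] unfolding higher_differentiable_on_pd pd_def
    by (auto simp: frechet_derivative_works powr_diff fun_eq_iff intro!: derivative_eq_intros)
  have "higher_differentiable_on S f n" "higher_differentiable_on S (pd w f) n" for w
    using higher_differentiable_on_Suc_imp[OF Suc.prems] Suc.prems
    by (auto simp: higher_differentiable_on_pd)
  then have "higher_differentiable_on S (\<lambda>x. a * (f x powr (a - 1) * pd w f x)) n" for w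
    by (intro higher_differentiable_on_bilinear[OF bounded_bilinear_mult assms(1)]
        higher_differentiable_on_const[OF assms(1)] Suc.IH)
  moreover have "a * (f x powr (a - 1) * pd w f x) = pd w (\<lambda>x. f x powr a) x" if "x \<in> S" for x w
    using pd_eqI[OF D[OF that]] by simp
  ultimately have "higher_differentiable_on S (pd w (\<lambda>x. f x powr a)) n" for w
    using higher_differentiable_on_cong[OF assms(1), of "\<lambda>x. a * (f x powr (a - 1) * pd w f x)"] by blast
  moreover have "(\<lambda>x. f x powr a) differentiable (at x)" if "x \<in> S" for x
    using D[OF that] unfolding differentiable_def by blast
  ultimately show ?case unfolding higher_differentiable_on_pd by blast
qed

lemma smooth_on_has_derivative:
  "smooth_on S f \<Longrightarrow> x \<in> S \<Longrightarrow> (f has_derivative (\<lambda>w. pd w f x)) (at x)"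
  unfolding smooth_on_def pd_def
  by (metis (no_types, lifting) ext frechet_derivative_works higher_differentiable_on.simps(2))

lemma smooth_on_differentiable: "smooth_on S f \<Longrightarrow> x \<in> S \<Longrightarrow> f differentiable (at x)"
  using smooth_on_has_derivative differentiable_def by blast

lemma smooth_on_pd: "smooth_on S f \<Longrightarrow> smooth_on S (pd w f)"
  unfolding smooth_on_def using higher_differentiable_on_pd by blast

lemma smooth_on_inner:
  "open S \<Longrightarrow> smooth_on S f \<Longrightarrow> smooth_on S g \<Longrightarrow> smooth_on S (\<lambda>x. f x \<bullet> g x)"
  unfolding smooth_on_def
  using higher_differentiable_on_bilinear[OF bounded_bilinear_inner] by blast

lemma smooth_on_const: "open S \<Longrightarrow> smooth_on S (\<lambda>x. c)"
  unfolding smooth_on_def using higher_differentiable_on_const by blast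

lemma smooth_on_sqrt:
  fixes f :: "'a::real_normed_vector \<Rightarrow> real"
  assumes "open S" "smooth_on S f" "\<And>x. x \<in> S \<Longrightarrow> f x > 0"
  shows "smooth_on S (\<lambda>x. sqrt (f x))"
  unfolding smooth_on_def
proof
  fix n
  have "higher_differentiable_on S (\<lambda>x. f x powr (1/2)) n"
    using assms unfolding smooth_on_def by (blast intro: higher_differentiable_on_powr)
  moreover have "f x powr (1/2) = sqrt (f x)" if "x \<in> S" for x
    using assms(3)[OF that] by (simp add: powr_half_sqrt)
  ultimately show "higher_differentiable_on S (\<lambda>x. sqrt (f x)) n"
    by (rule higher_differentiable_on_cong[OF assms(1), rotated])
qed

lemma smooth_on_add: "open S \<Longrightarrow> smooth_on S f \<Longrightarrow> smooth_on S g \<Longrightarrow> smooth_on S (\<lambda>x. f x + g x)"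
  unfolding smooth_on_def using higher_differentiable_on_add by blast

lemma smooth_on_scaleR:
  "open S \<Longrightarrow> smooth_on S f \<Longrightarrow> smooth_on S g \<Longrightarrow> smooth_on S (\<lambda>x. f x *\<^sub>R g x)"
  unfolding smooth_on_def
  using higher_differentiable_on_bilinear[OF bounded_bilinear_scaleR] by blast

text \<open>Two applications of the mean value theorem turn the second difference of \<open>f\<close> over a
  small parallelogram into a value of \<open>pd w' (pd w f)\<close>. The second difference is symmetric
  in \<open>w\<close> and \<open>w'\<close>, which gives Schwarz's theorem.\<close>

lemma second_difference_mean_value:
  fixes f :: "'a::real_normed_vector \<Rightarrow> real"
  assumes "smooth_on S f" "s > 0"
    and S: "\<And>x y. 0 \<le> x \<Longrightarrow> x \<le> s \<Longrightarrow> 0 \<le> y \<Longrightarrow> y \<le> s \<Longrightarrow> p + x *\<^sub>R w + y *\<^sub>R w' \<in> S"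
  shows "\<exists>x y. 0 \<le> x \<and> x \<le> s \<and> 0 \<le> y \<and> y \<le> s \<and>
    f (p + s *\<^sub>R w + s *\<^sub>R w') - f (p + s *\<^sub>R w) - f (p + s *\<^sub>R w') + f p
      = s * s * pd w' (pd w f) (p + x *\<^sub>R w + y *\<^sub>R w')"
proof -
  define g where "g x = f (p + x *\<^sub>R w + s *\<^sub>R w') - f (p + x *\<^sub>R w)" for x
  have lin: "pd (c *\<^sub>R v) h q = c * pd v h q" if "smooth_on S h" "q \<in> S" for c v q and h :: "'a \<Rightarrow> real"
    using linear_scale[OF has_derivative_linear[OF smooth_on_has_derivative[OF that]]] by simp
  have dg: "(g has_derivative (\<lambda>h. h * (pd w f (p + x *\<^sub>R w + s *\<^sub>R w') - pd w f (p + x *\<^sub>R w)))) (at x)"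
    if "0 \<le> x" "x \<le> s" for x
  proof -
    have "((\<lambda>x. f (p + x *\<^sub>R w + s *\<^sub>R w')) has_derivative (\<lambda>h. pd (h *\<^sub>R w) f (p + x *\<^sub>R w + s *\<^sub>R w'))) (at x)"
      by (rule has_derivative_compose[where g=f, OF _ smooth_on_has_derivative[OF assms(1)]])
         (auto intro!: derivative_eq_intros S that assms(2)[THEN less_imp_le])
    moreover have "((\<lambda>x. f (p + x *\<^sub>R w)) has_derivative (\<lambda>h. pd (h *\<^sub>R w) f (p + x *\<^sub>R w))) (at x)"
      by (rule has_derivative_compose[where g=f, OF _ smooth_on_has_derivative[OF assms(1)]])
         (use S[of x 0] that assms in \<open>auto intro!: derivative_eq_intros\<close>)
    ultimately show ?thesis unfolding g_def
      using lin[OF assms(1), of "p + x *\<^sub>R w + s *\<^sub>R w'"] lin[OF assms(1), of "p + x *\<^sub>R w"] S[of x 0] S[of x s] that assms(2)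
      by (auto intro!: derivative_eq_intros simp: fun_eq_iff algebra_simps)
  qed
  have "\<exists>x. 0 < x \<and> x < s \<and> g s - g 0 = (s - 0) * (pd w f (p + x *\<^sub>R w + s *\<^sub>R w') - pd w f (p + x *\<^sub>R w))"
    using mvt_simple[OF assms(2), of g "\<lambda>x h. h * (pd w f (p + x *\<^sub>R w + s *\<^sub>R w') - pd w f (p + x *\<^sub>R w))"]
      has_derivative_at_withinI[OF dg] by auto
  then obtain x where x: "0 < x" "x < s" 
    "g s - g 0 = s * (pd w f (p + x *\<^sub>R w + s *\<^sub>R w') - pd w f (p + x *\<^sub>R w))"
    by auto
  have "((\<lambda>y. pd w f (p + x *\<^sub>R w + y *\<^sub>R w')) has_derivative
      (\<lambda>h. h * pd w' (pd w f) (p + x *\<^sub>R w + y *\<^sub>R w'))) (at y)" if "0 \<le> y" "y \<le> s" for y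
  proof -
    have "((\<lambda>y. pd w f (p + x *\<^sub>R w + y *\<^sub>R w')) has_derivative
      (\<lambda>h. pd (h *\<^sub>R w') (pd w f) (p + x *\<^sub>R w + y *\<^sub>R w'))) (at y)"
      by (rule has_derivative_compose[where g="pd w f", OF _ smooth_on_has_derivative[OF smooth_on_pd[OF assms(1)]]])
         (use that x in \<open>auto intro!: derivative_eq_intros S\<close>)
    then show ?thesis using that x by (simp add: lin smooth_on_pd assms S)
  qed
  from mvt_simple[OF assms(2), of "\<lambda>y. pd w f (p + x *\<^sub>R w + y *\<^sub>R w')", OF has_derivative_at_withinI[OF this]]
  obtain y where y: "0 < y" "y < s"
    "pd w f (p + x *\<^sub>R w + s *\<^sub>R w') - pd w f (p + x *\<^sub>R w) = s * pd w' (pd w f) (p + x *\<^sub>R w + y *\<^sub>R w')"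
    by auto
  show ?thesis using x y by (intro exI[of _ x] exI[of _ y]) (simp add: g_def)
qed

lemma pd_commute_real:
  fixes f :: "'a::real_normed_vector \<Rightarrow> real"
  assumes "open S" "smooth_on S f" "p \<in> S"
  shows "pd w (pd w' f) p = pd w' (pd w f) p"
proof (rule ccontr)
  define F G where "F = pd w (pd w' f)" and "G = pd w' (pd w f)"
  assume "pd w (pd w' f) p \<noteq> pd w' (pd w f) p"
  then have e: "\<bar>F p - G p\<bar> / 2 > 0" by (simp add: F_def G_def)
  have "isCont F p" "isCont G p"
    using assms by (auto simp: F_def G_def intro!: differentiable_imp_continuous_within
        smooth_on_differentiable smooth_on_pd)
  then obtain d1 d2 where d: "d1 > 0" "\<And>x. dist x p < d1 \<Longrightarrow> dist (F x) (F p) < \<bar>F p - G p\<bar> / 2"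
     "d2 > 0" "\<And>x. dist x p < d2 \<Longrightarrow> dist (G x) (G p) < \<bar>F p - G p\<bar> / 2"
    using e unfolding continuous_at_eps_delta by blast
  obtain d3 where d3: "d3 > 0" "\<And>x. dist x p < d3 \<Longrightarrow> x \<in> S"
    using assms unfolding open_dist by blast
  define d where "d = min d1 (min d2 d3)"
  define s where "s = d / (2 * (norm w + norm w' + 1))"
  have dpos: "d > 0" using d d3 by (simp add: d_def)
  have pos: "norm w + norm w' + 1 > 0" by (smt (verit) norm_ge_zero)
  then have "s > 0" using dpos by (simp add: s_def)
  have near: "dist (p + x *\<^sub>R w + y *\<^sub>R w') p < d" if "0 \<le> x" "x \<le> s" "0 \<le> y" "y \<le> s" for x y
  proof -
    have "dist (p + x *\<^sub>R w + y *\<^sub>R w') p = norm (x *\<^sub>R w + y *\<^sub>R w')"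
      by (simp add: dist_norm add.assoc)
    also have "\<dots> \<le> x * norm w + y * norm w'"
      by (rule norm_triangle_le) (simp add: that)
    also have "\<dots> \<le> s * norm w + s * norm w'"
      using that by (intro add_mono mult_right_mono) auto
    also have "\<dots> \<le> s * (norm w + norm w' + 1)" using \<open>s > 0\<close> by (simp add: algebra_simps)
    also have "\<dots> = d / 2" unfolding s_def using pos by (simp add: field_simps)
    also have "\<dots> < d" using dpos by simp
    finally show ?thesis .
  qed
  obtain x y where xy: "0 \<le> x" "x \<le> s" "0 \<le> y" "y \<le> s" 
    "f (p + s *\<^sub>R w + s *\<^sub>R w') - f (p + s *\<^sub>R w) - f (p + s *\<^sub>R w') + f p
      = s * s * G (p + x *\<^sub>R w + y *\<^sub>R w')"
    unfolding G_def using second_difference_mean_value[OF assms(2) \<open>s > 0\<close>, of p w w'] near d3(2)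
    by (metis d_def min_less_iff_conj)
  obtain x' y' where xy': "0 \<le> x'" "x' \<le> s" "0 \<le> y'" "y' \<le> s" 
    "f (p + s *\<^sub>R w' + s *\<^sub>R w) - f (p + s *\<^sub>R w') - f (p + s *\<^sub>R w) + f p
      = s * s * F (p + y' *\<^sub>R w + x' *\<^sub>R w')"
    unfolding F_def using second_difference_mean_value[OF assms(2) \<open>s > 0\<close>, of p w' w] near d3(2)
    by (smt (verit) add.commute add.left_commute d_def)
  have "G (p + x *\<^sub>R w + y *\<^sub>R w') = F (p + y' *\<^sub>R w + x' *\<^sub>R w')"
    proof -
    have "s * s * G (p + x *\<^sub>R w + y *\<^sub>R w') = s * s * F (p + y' *\<^sub>R w + x' *\<^sub>R w')"
      using xy(5) xy'(5) unfolding add.commute[of "s *\<^sub>R w'"] add.assoc by linarith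
    then show ?thesis using \<open>s > 0\<close> by simp
  qed
  moreover have "dist (G (p + x *\<^sub>R w + y *\<^sub>R w')) (G p) < \<bar>F p - G p\<bar> / 2"
    "dist (F (p + y' *\<^sub>R w + x' *\<^sub>R w')) (F p) < \<bar>F p - G p\<bar> / 2"
    using d(2,4) near xy xy' by (auto simp: d_def)
  ultimately show False unfolding dist_real_def by (smt (verit, best) field_sum_of_halves)
qed

lemma pd_inner_const:
  assumes "smooth_on S f" "p \<in> S"
  shows "pd w (\<lambda>x. f x \<bullet> c) p = pd w f p \<bullet> c"
  by (rule pd_eqI) (intro has_derivative_inner_left smooth_on_has_derivative[OF assms])

lemma pd_commute:
  fixes f :: "'a::real_normed_vector \<Rightarrow> 'b::real_inner"
  assumes "open S" "smooth_on S f" "p \<in> S"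
  shows "pd w (pd w' f) p = pd w' (pd w f) p"
proof -
  have *: "pd w (pd w' f) p \<bullet> c = pd w (pd w' (\<lambda>x. f x \<bullet> c)) p" for w w' c
  proof -
    have "pd w (pd w' f) p \<bullet> c = pd w (\<lambda>x. pd w' f x \<bullet> c) p"
      by (simp add: pd_inner_const[OF smooth_on_pd[OF assms(2)] assms(3)])
    also have "\<dots> = pd w (pd w' (\<lambda>x. f x \<bullet> c)) p"
      using assms by (intro pd_cong[of S] smooth_on_differentiable[of S] smooth_on_inner smooth_on_pd
          smooth_on_const) (simp_all add: pd_inner_const)
    finally show ?thesis .
  qed
  have "pd w (pd w' f) p \<bullet> c = pd w' (pd w f) p \<bullet> c" for c
    unfolding * using assms by (intro pd_commute_real[of S] smooth_on_inner smooth_on_const)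
  then show ?thesis by (metis vector_eq_ldot inner_commute)
qed

lemma smooth_on_has_derivative_coords:
  fixes f :: "real \<times> real \<Rightarrow> 'b::real_normed_vector"
  assumes "smooth_on S f" "z \<in> S"
  shows "(f has_derivative (\<lambda>w. fst w *\<^sub>R pd (1, 0) f z + snd w *\<^sub>R pd (0, 1) f z)) (at z)"
proof -
  note D = smooth_on_has_derivative[OF assms]
  have "pd w f z = fst w *\<^sub>R pd (1, 0) f z + snd w *\<^sub>R pd (0, 1) f z" for w
  proof -
    have "pd w f z = pd (fst w *\<^sub>R (1, 0) + snd w *\<^sub>R (0, 1)) f z" by (cases w) simp
    also have "\<dots> = fst w *\<^sub>R pd (1, 0) f z + snd w *\<^sub>R pd (0, 1) f z"
      unfolding linear_add[OF has_derivative_linear[OF D]] linear_scale[OF has_derivative_linear[OF D]] ..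
    finally show ?thesis .
  qed
  then show ?thesis by (intro has_derivative_eq_rhs[OF D] ext)
qed

lemma pd_inner:
  assumes "smooth_on S f" "smooth_on S g" "z \<in> S"
  shows "pd w (\<lambda>x. f x \<bullet> g x) z = f z \<bullet> pd w g z + pd w f z \<bullet> g z"
  using pd_eqI[OF has_derivative_inner[OF smooth_on_has_derivative[OF assms(1,3)]
      smooth_on_has_derivative[OF assms(2,3)]]] .

lemma pd_mult:
  fixes f g :: "'a::real_normed_vector \<Rightarrow> real"
  assumes "smooth_on S f" "smooth_on S g" "z \<in> S"
  shows "pd w (\<lambda>x. f x * g x) z = f z * pd w g z + pd w f z * g z"
  using pd_inner[OF assms] by (simp add: inner_real_def)

lemma smooth_on_mult:
  fixes f g :: "'a::real_normed_vector \<Rightarrow> real"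
  shows "open S \<Longrightarrow> smooth_on S f \<Longrightarrow> smooth_on S g \<Longrightarrow> smooth_on S (\<lambda>x. f x * g x)"
  using smooth_on_inner[of S f g] by (simp add: inner_real_def)

lemma pd_constant_on:
  assumes "open U" "z \<in> U" "\<And>x. x \<in> U \<Longrightarrow> f x = c"
  shows "pd w f z = 0"
proof -
  have "pd w f z = pd w (\<lambda>x. c) z"
    using assms by (intro pd_cong[of U, symmetric]) auto
  then show ?thesis by (simp add: pd_def)
qed

text \<open>The function \<open>g\<close> may vary off the line, so this does not follow from \<open>pd_constant_on\<close>.\<close>

lemma pd_zero_on_line:
  fixes g :: "'a::real_normed_vector \<Rightarrow> real"
  assumes g: "smooth_on U g" and I: "open I" "t \<in> I" and line: "\<And>s. s \<in> I \<Longrightarrow> z + s *\<^sub>R w \<in> U"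
    and c: "\<And>s. s \<in> I \<Longrightarrow> g (z + s *\<^sub>R w) = c"
  shows "pd w g (z + t *\<^sub>R w) = 0"
proof -
  have "((\<lambda>s. g (z + s *\<^sub>R w)) has_derivative (\<lambda>h. pd (h *\<^sub>R w) g (z + t *\<^sub>R w))) (at t)"
    by (rule has_derivative_compose[where g = g and f = "\<lambda>s. z + s *\<^sub>R w" and f' = "\<lambda>h. h *\<^sub>R w",
          OF _ smooth_on_has_derivative[OF g line[OF I(2)]]])
       (auto intro!: derivative_eq_intros)
  moreover have "((\<lambda>s. g (z + s *\<^sub>R w)) has_derivative (\<lambda>h. 0)) (at t)"
    by (rule has_derivative_transform_within_open[OF _ I, of "\<lambda>s. c"]) (simp_all add: c)
  ultimately have "(\<lambda>h. pd (h *\<^sub>R w) g (z + t *\<^sub>R w)) = (\<lambda>h. 0)" by (rule has_derivative_unique)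
  from fun_cong[OF this, of 1] show ?thesis by simp
qed

section \<open>Adapted frames and rigidity\<close>

definition orthonormal3 :: "real^3 \<Rightarrow> real^3 \<Rightarrow> real^3 \<Rightarrow> bool" where
  "orthonormal3 e f n \<longleftrightarrow>
     e \<bullet> e = 1 \<and> f \<bullet> f = 1 \<and> n \<bullet> n = 1 \<and> e \<bullet> f = 0 \<and> e \<bullet> n = 0 \<and> f \<bullet> n = 0"

lemma orthonormal3_expand:
  assumes "orthonormal3 e f n"
  shows "x = (x \<bullet> e) *\<^sub>R e + (x \<bullet> f) *\<^sub>R f + (x \<bullet> n) *\<^sub>R n"
proof -
  let ?B = "{e, f, n}"
  have ne: "e \<noteq> f" "e \<noteq> n" "f \<noteq> n" "0 \<notin> ?B"
    using assms by (auto simp: orthonormal3_def)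
  have B: "pairwise orthogonal ?B"
    using assms by (auto simp: pairwise_def orthogonal_def orthonormal3_def inner_commute)
  have "card ?B = DIM(real^3)" using ne by simp
  moreover have "independent ?B" using B ne(4) by (rule pairwise_orthogonal_independent)
  ultimately have "span ?B = UNIV"
    by (metis dim_eq_card dim_eq_full)
  then have "(\<Sum>i\<in>?B. (x \<bullet> i) *\<^sub>R i) = x"
    using assms by (intro orthonormal_basis_expand[OF B]) (auto simp: orthonormal3_def norm_eq_1)
  then show ?thesis using ne by (simp add: add.assoc)
qed

lemma orthonormal3_norm:
  assumes "orthonormal3 e f n"
  shows "(norm (a *\<^sub>R e + b *\<^sub>R f + c *\<^sub>R n))\<^sup>2 = a\<^sup>2 + b\<^sup>2 + c\<^sup>2"
  using assms unfolding orthonormal3_def power2_norm_eq_inner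
  by (simp add: inner_simps inner_commute power2_eq_square)

text \<open>The first derivative is the conformal factor \<open>\<rho>\<close> with gradient \<open>(p, q)\<close>. The remaining
  ones are the Gauss-Weingarten equations of a surface with first fundamental form
  \<open>\<rho>\<^sup>2 (du\<^sup>2 + dv\<^sup>2)\<close> and second fundamental form \<open>-du\<^sup>2 + dv\<^sup>2\<close>, written for the
  normalized frame \<open>e = X\<^sub>u / \<rho>\<close>, \<open>f = X\<^sub>v / \<rho>\<close>, \<open>n\<close>. Normalization makes their
  coefficient matrices skew-symmetric.\<close>

definition isothermic_frame ::
  "(real \<times> real) set \<Rightarrow> (real \<times> real \<Rightarrow> real) \<Rightarrow> (real \<times> real \<Rightarrow> real) \<Rightarrow> (real \<times> real \<Rightarrow> real) \<Rightarrow>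
   (real \<times> real \<Rightarrow> real^3) \<Rightarrow> (real \<times> real \<Rightarrow> real^3) \<Rightarrow> (real \<times> real \<Rightarrow> real^3) \<Rightarrow>
   (real \<times> real \<Rightarrow> real^3) \<Rightarrow> bool" where
  "isothermic_frame U \<rho> p q X e f n \<longleftrightarrow> (\<forall>z\<in>U.
     \<rho> z > 0 \<and> orthonormal3 (e z) (f z) (n z) \<and>
     (\<rho> has_derivative (\<lambda>w. fst w * p z + snd w * q z)) (at z) \<and>
     (X has_derivative (\<lambda>w. (fst w * \<rho> z) *\<^sub>R e z + (snd w * \<rho> z) *\<^sub>R f z)) (at z) \<and>
     (e has_derivative (\<lambda>w. fst w *\<^sub>R (- (q z / \<rho> z) *\<^sub>R f z - (1 / \<rho> z) *\<^sub>R n z)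
                          + snd w *\<^sub>R ((p z / \<rho> z) *\<^sub>R f z))) (at z) \<and>
     (f has_derivative (\<lambda>w. fst w *\<^sub>R ((q z / \<rho> z) *\<^sub>R e z)
                          + snd w *\<^sub>R (- (p z / \<rho> z) *\<^sub>R e z + (1 / \<rho> z) *\<^sub>R n z))) (at z) \<and>
     (n has_derivative (\<lambda>w. fst w *\<^sub>R ((1 / \<rho> z) *\<^sub>R e z) - snd w *\<^sub>R ((1 / \<rho> z) *\<^sub>R f z))) (at z))"

lemma isothermic_frame_subset:
  "isothermic_frame V \<rho> p q X e f n \<Longrightarrow> U \<subseteq> V \<Longrightarrow> isothermic_frame U \<rho> p q X e f n"
  unfolding isothermic_frame_def by blast

text \<open>The orthogonal map \<open>R\<close> sending the frame of \<open>Y\<close> to that of \<open>X\<close> is constant: both frames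
  satisfy the same linear equations with skew-symmetric coefficients, so the two contributions to
  its derivative cancel. Then \<open>X - R Y\<close> is constant too.\<close>

lemma isothermic_frame_rigidity:
  assumes "open U" "connected U"
    and X: "isothermic_frame U \<rho> p q X e f n"
    and Y: "isothermic_frame U \<rho>' p' q' Y e' f' n'"
    and eq: "\<And>z. z \<in> U \<Longrightarrow> \<rho> z = \<rho>' z"
  shows "\<exists>T. isometry_of_space T \<and> (\<forall>z\<in>U. X z = T (Y z))"
proof (cases "U = {}")
  case True
  then show ?thesis by (auto simp: isometry_of_space_def intro!: exI[of _ id])
next
  case False
  then obtain z0 where z0: "z0 \<in> U" by blast
  \<comment> \<open>The gradients agree because the conformal factors agree on an open set.\<close>
  have pq: "p' z = p z" "q' z = q z" if "z \<in> U" for z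
  proof -
    have "(\<rho> has_derivative (\<lambda>w. fst w * p z + snd w * q z)) (at z)"
      using X that by (auto simp: isothermic_frame_def)
    then have "(\<rho>' has_derivative (\<lambda>w. fst w * p z + snd w * q z)) (at z)"
      by (rule has_derivative_transform_within_open[OF _ assms(1) that]) (simp add: eq)
    moreover have "(\<rho>' has_derivative (\<lambda>w. fst w * p' z + snd w * q' z)) (at z)"
      using Y that by (auto simp: isothermic_frame_def)
    ultimately have "(\<lambda>w. fst w * p z + snd w * q z) = (\<lambda>w. fst w * p' z + snd w * q' z)"
      by (rule has_derivative_unique)
    from fun_cong[OF this, of "(1,0)"] fun_cong[OF this, of "(0,1)"]
    show "p' z = p z" "q' z = q z" by auto
  qed
  define R where "R z x = (x \<bullet> e' z) *\<^sub>R e z + (x \<bullet> f' z) *\<^sub>R f z + (x \<bullet> n' z) *\<^sub>R n z" for z x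
  have dR: "((\<lambda>z. R z x) has_derivative (\<lambda>w. 0)) (at z)" if "z \<in> U" for z x
  proof -
    have d: "(e has_derivative (\<lambda>w. fst w *\<^sub>R (- (q z / \<rho> z) *\<^sub>R f z - (1 / \<rho> z) *\<^sub>R n z)
                          + snd w *\<^sub>R ((p z / \<rho> z) *\<^sub>R f z))) (at z)"
     "(f has_derivative (\<lambda>w. fst w *\<^sub>R ((q z / \<rho> z) *\<^sub>R e z)
                          + snd w *\<^sub>R (- (p z / \<rho> z) *\<^sub>R e z + (1 / \<rho> z) *\<^sub>R n z))) (at z)"
     "(n has_derivative (\<lambda>w. fst w *\<^sub>R ((1 / \<rho> z) *\<^sub>R e z) - snd w *\<^sub>R ((1 / \<rho> z) *\<^sub>R f z))) (at z)"
     "(e' has_derivative (\<lambda>w. fst w *\<^sub>R (- (q z / \<rho> z) *\<^sub>R f' z - (1 / \<rho> z) *\<^sub>R n' z)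
                          + snd w *\<^sub>R ((p z / \<rho> z) *\<^sub>R f' z))) (at z)"
     "(f' has_derivative (\<lambda>w. fst w *\<^sub>R ((q z / \<rho> z) *\<^sub>R e' z)
                          + snd w *\<^sub>R (- (p z / \<rho> z) *\<^sub>R e' z + (1 / \<rho> z) *\<^sub>R n' z))) (at z)"
     "(n' has_derivative (\<lambda>w. fst w *\<^sub>R ((1 / \<rho> z) *\<^sub>R e' z) - snd w *\<^sub>R ((1 / \<rho> z) *\<^sub>R f' z))) (at z)"
      using X Y that by (auto simp: isothermic_frame_def pq eq)
    show ?thesis unfolding R_def
      by (rule derivative_eq_intros d refl)+ (simp add: fun_eq_iff inner_simps algebra_simps)
  qed
  have R: "R z x = R z0 x" if "z \<in> U" for z x
    by (rule has_derivative_zero_unique_connected[OF assms(1,2) dR that z0])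
  have Rf: "R z0 (e' z) = e z" "R z0 (f' z) = f z" if "z \<in> U" for z
    unfolding R[OF that, symmetric] unfolding R_def using Y that
    by (auto simp: isothermic_frame_def orthonormal3_def inner_commute)
  have Radd: "R z0 (x + y) = R z0 x + R z0 y" and Rscale: "R z0 (a *\<^sub>R x) = a *\<^sub>R R z0 x" for x y a
    by (simp_all add: R_def inner_simps algebra_simps)
  have "((\<lambda>z. X z - R z0 (Y z)) has_derivative (\<lambda>w. 0)) (at z)" if "z \<in> U" for z
  proof -
    have dX: "(X has_derivative (\<lambda>w. (fst w * \<rho> z) *\<^sub>R e z + (snd w * \<rho> z) *\<^sub>R f z)) (at z)"
      and dY: "(Y has_derivative (\<lambda>w. (fst w * \<rho> z) *\<^sub>R e' z + (snd w * \<rho> z) *\<^sub>R f' z)) (at z)"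
      using X Y that by (auto simp: isothermic_frame_def eq)
    have "((\<lambda>z. R z0 (Y z)) has_derivative
        (\<lambda>w. R z0 ((fst w * \<rho> z) *\<^sub>R e' z + (snd w * \<rho> z) *\<^sub>R f' z))) (at z)"
      unfolding R_def by (intro derivative_intros dY)
    from has_derivative_diff[OF dX this] show ?thesis
      by (simp add: Radd Rscale Rf that)
  qed
  from has_derivative_zero_unique_connected[OF assms(1,2) this _ z0]
  have "X z = R z0 (Y z) + (X z0 - R z0 (Y z0))" if "z \<in> U" for z
    using that by (metis (no_types, lifting) add.commute diff_add_cancel)
  moreover have "isometry_of_space (\<lambda>y. R z0 y + (X z0 - R z0 (Y z0)))"
  proof -
    have "norm (R z0 y) = norm y" for y
    proof -
      have "orthonormal3 (e z0) (f z0) (n z0)" "orthonormal3 (e' z0) (f' z0) (n' z0)"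
        using X Y z0 by (auto simp: isothermic_frame_def)
      then have "(norm (R z0 y))\<^sup>2 = (norm y)\<^sup>2"
        by (subst (2) orthonormal3_expand[of "e' z0" "f' z0" "n' z0"])
           (simp_all add: R_def orthonormal3_norm)
      then show ?thesis by simp
    qed
    moreover have "R z0 x - R z0 y = R z0 (x - y)" for x y
      by (metis Radd add_diff_cancel_right' diff_add_cancel)
    ultimately show ?thesis by (simp add: isometry_of_space_def dist_norm)
  qed
  ultimately show ?thesis by blast
qed

lemma has_derivative_comp_swap:
  fixes g :: "real \<times> real \<Rightarrow> 'a::real_normed_vector"
  assumes "(g has_derivative g') (at (u, v))"
  shows "((\<lambda>x. g (prod.swap x)) has_derivative (\<lambda>w. g' (prod.swap w))) (at (v, u))"
proof -
  have "(prod.swap has_derivative prod.swap) (at (v, u))"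
    unfolding prod.swap_def by (auto intro!: derivative_eq_intros)
  from has_derivative_compose[OF this, of g g'] assms show ?thesis by simp
qed

text \<open>Exchanging the parameters exchanges \<open>e\<close> and \<open>f\<close>. It also turns the second fundamental form
  into \<open>du\<^sup>2 - dv\<^sup>2\<close>, which is why the normal changes sign.\<close>

lemma isothermic_frame_swap:
  assumes "isothermic_frame U \<rho> p q X e f n"
  shows "isothermic_frame (prod.swap ` U) (\<rho> \<circ> prod.swap) (q \<circ> prod.swap) (p \<circ> prod.swap)
    (X \<circ> prod.swap) (f \<circ> prod.swap) (e \<circ> prod.swap) (\<lambda>z. - n (prod.swap z))"
  unfolding isothermic_frame_def
proof (rule ballI, goal_cases)
  case (1 z)
  then obtain u v where uv: "(u, v) \<in> U" and z: "z = (v, u)" by auto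
  note c = has_derivative_comp_swap
  show ?case
    using assms[unfolded isothermic_frame_def, rule_format, OF uv] unfolding z o_def
    apply (elim conjE)
    apply (intro conjI)
          apply simp
         apply (simp add: orthonormal3_def inner_commute)
        apply (rule has_derivative_eq_rhs[OF c], assumption, simp add: fun_eq_iff algebra_simps)
       apply (rule has_derivative_eq_rhs[OF c], assumption, simp add: fun_eq_iff algebra_simps)
      apply (rule has_derivative_eq_rhs[OF c], assumption, simp add: fun_eq_iff algebra_simps)
     apply (rule has_derivative_eq_rhs[OF c], assumption, simp add: fun_eq_iff algebra_simps)
    apply (rule has_derivative_eq_rhs[OF has_derivative_minus[OF c]], assumption, simp add: fun_eq_iff algebra_simps)
    done
qed

text \<open>Stretching the parameters by \<open>\<mu>\<close> multiplies the second fundamental form by \<open>\<mu>\<^sup>2\<close>. The factor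
  \<open>1 / \<mu>\<^sup>2\<close> in space is the one that restores \<open>-du\<^sup>2 + dv\<^sup>2\<close>.\<close>

lemma isothermic_frame_rescale:
  fixes \<mu> a b :: real
  assumes "isothermic_frame UNIV \<rho> p q X e f n" "\<mu> > 0"
  defines "\<phi> \<equiv> \<lambda>z. (\<mu> * fst z + a, \<mu> * snd z + b)"
  shows "isothermic_frame UNIV (\<lambda>z. \<rho> (\<phi> z) / \<mu>) (\<lambda>z. p (\<phi> z)) (\<lambda>z. q (\<phi> z))
    (\<lambda>z. (1 / \<mu>\<^sup>2) *\<^sub>R X (\<phi> z)) (\<lambda>z. e (\<phi> z)) (\<lambda>z. f (\<phi> z)) (\<lambda>z. n (\<phi> z))"
  unfolding isothermic_frame_def
proof (rule ballI, goal_cases)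
  case (1 z)
  have s: "(\<phi> has_derivative (\<lambda>w. \<mu> *\<^sub>R w)) (at z)"
    unfolding \<phi>_def by (auto intro!: derivative_eq_intros simp: scaleR_prod_def)
  have c: "((\<lambda>z. g (\<phi> z)) has_derivative (\<lambda>w. g' (\<mu> *\<^sub>R w))) (at z)"
    if "(g has_derivative g') (at (\<phi> z))" for g :: "real \<times> real \<Rightarrow> 'a::real_normed_vector" and g'
    by (rule has_derivative_compose[OF s that])
  have c': "((\<lambda>z. r *\<^sub>R g (\<phi> z)) has_derivative (\<lambda>w. r *\<^sub>R g' (\<mu> *\<^sub>R w))) (at z)"
    if "(g has_derivative g') (at (\<phi> z))" for g :: "real \<times> real \<Rightarrow> 'a::real_normed_vector" and g' r
    by (rule has_derivative_scaleR_right[OF c[OF that]])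
  show ?case
    using assms(1)[unfolded isothermic_frame_def, rule_format, OF UNIV_I, of "\<phi> z"] assms(2)
    apply (elim conjE)
    apply (intro conjI)
          apply simp
         apply assumption
        apply (rule has_derivative_eq_rhs[OF has_derivative_mult_left[OF c, where y = "inverse \<mu>", folded divide_inverse]], assumption, simp add: field_simps fun_eq_iff)
       apply (rule has_derivative_eq_rhs[OF c'], assumption, simp add: fun_eq_iff scaleR_add_right power2_eq_square field_simps)
      apply (rule has_derivative_eq_rhs[OF c], assumption, simp add: fun_eq_iff algebra_simps)
     apply (rule has_derivative_eq_rhs[OF c], assumption, simp add: fun_eq_iff algebra_simps)
    apply (rule has_derivative_eq_rhs[OF c], assumption, simp add: fun_eq_iff algebra_simps)
    done
qed

section \<open>Minimal surfaces in isothermic coordinates\<close>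

lemma diff_u_eq_pd: "diff_u f = pd (1, 0) f" and diff_v_eq_pd: "diff_v f = pd (0, 1) f"
  by (simp_all add: fun_eq_iff diff_u_def diff_v_def pd_def)

locale isothermic_minimal_surface =
  fixes U :: "(real \<times> real) set" and X N :: "real \<times> real \<Rightarrow> real^3"
  assumes U: "open U"
    and conformal: "conformal_immersion_on U X"
    and normal: "unit_normal_on U X N"
    and minimal: "minimal_on U X N"
    and curvature_lines: "curvature_line_coordinates_on U X N"
    and hopf: "z \<in> U \<Longrightarrow> hopf_factor X N z = - 1 / 2"
begin

definition Xu where "Xu = pd (1, 0) X"
definition Xv where "Xv = pd (0, 1) X"
definition \<rho> where "\<rho> z = sqrt (Xu z \<bullet> Xu z)"
definition p where "p = pd (1, 0) \<rho>"
definition q where "q = pd (0, 1) \<rho>"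
definition P where "P = pd (1, 0) p"
definition Q where "Q = pd (0, 1) q"
definition e where "e z = (1 / \<rho> z) *\<^sub>R Xu z"
definition f where "f z = (1 / \<rho> z) *\<^sub>R Xv z"

lemma smooth_X: "smooth_on U X" and smooth_N: "smooth_on U N"
  using conformal normal unfolding conformal_immersion_on_def unit_normal_on_def by blast+

lemma smooth_Xu: "smooth_on U Xu" and smooth_Xv: "smooth_on U Xv"
  by (simp_all add: Xu_def Xv_def smooth_on_pd smooth_X)

context
  fixes z assumes z: "z \<in> U"
begin

lemma Xu_nonzero: "Xu z \<noteq> 0"
proof
  assume "Xu z = 0"
  then have "frechet_derivative X (at z) (1, 0) = frechet_derivative X (at z) 0"
    using linear_0[OF has_derivative_linear[OF smooth_on_has_derivative[OF smooth_X z]]]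
    by (simp add: Xu_def pd_def)
  moreover have "inj (frechet_derivative X (at z))"
    using conformal z by (simp add: conformal_immersion_on_def)
  ultimately show False by (simp add: inj_eq zero_prod_def)
qed

lemma rho_pos: "\<rho> z > 0"
  using Xu_nonzero by (simp add: \<rho>_def)

lemma first_fundamental_form:
  "Xu z \<bullet> Xu z = \<rho> z * \<rho> z" "Xv z \<bullet> Xv z = \<rho> z * \<rho> z" "Xu z \<bullet> Xv z = 0"
  using conformal z
  by (auto simp: conformal_immersion_on_def diff_u_eq_pd diff_v_eq_pd Xu_def Xv_def \<rho>_def)

lemma normal_orthogonal: "N z \<bullet> N z = 1" "N z \<bullet> Xu z = 0" "N z \<bullet> Xv z = 0"
  using normal z by (auto simp: unit_normal_on_def diff_u_eq_pd diff_v_eq_pd Xu_def Xv_def norm_eq_1)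

lemma orthonormal: "orthonormal3 (e z) (f z) (N z)"
  using first_fundamental_form normal_orthogonal rho_pos
  by (simp add: orthonormal3_def e_def f_def inner_commute)

lemma Xu_eq: "Xu z = \<rho> z *\<^sub>R e z" and Xv_eq: "Xv z = \<rho> z *\<^sub>R f z"
  using rho_pos by (simp_all add: e_def f_def)

text \<open>The Hopf factor gives the difference of the diagonal coefficients and the vanishing of the mixed
  one; minimality in conformal coordinates gives that the diagonal coefficients add up to zero.\<close>

lemma second_fundamental_form:
  "pd (1, 0) Xu z \<bullet> N z = -1" "pd (0, 1) Xu z \<bullet> N z = 0" "pd (0, 1) Xv z \<bullet> N z = 1"
proof -
  let ?l = "pd (1, 0) Xu z \<bullet> N z" and ?m = "pd (0, 1) Xu z \<bullet> N z" and ?n = "pd (0, 1) Xv z \<bullet> N z"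
  have h: "(complex_of_real ?l - 2 * \<i> * complex_of_real ?m - complex_of_real ?n) / 4 = - 1 / 2"
    using hopf[OF z] by (simp add: hopf_factor_def diff_u_eq_pd diff_v_eq_pd Xu_def Xv_def)
  have "?m = 0" using arg_cong[OF h, of Im] by simp
  moreover have "?l - ?n = -2" using arg_cong[OF h, of Re] by simp
  moreover have "?l + ?n = 0"
  proof -
    have "mean_curvature X N z = 0" using minimal z by (simp add: minimal_on_def)
    then have "(\<rho> z * \<rho> z * ?n + \<rho> z * \<rho> z * ?l) / (2 * (\<rho> z * \<rho> z * (\<rho> z * \<rho> z))) = 0"
      using first_fundamental_form
      by (simp add: mean_curvature_def Let_def diff_u_eq_pd diff_v_eq_pd Xu_def Xv_def)
    then have "\<rho> z * \<rho> z * (?l + ?n) = 0" using rho_pos by (simp add: algebra_simps)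
    then show ?thesis using rho_pos by simp
  qed
  ultimately show "?l = -1" "?m = 0" "?n = 1" by auto
qed

end

lemma smooth_rho: "smooth_on U \<rho>"
  unfolding \<rho>_def using Xu_nonzero by (intro smooth_on_sqrt smooth_on_inner U smooth_Xu) auto

lemma smooth_p: "smooth_on U p" and smooth_q: "smooth_on U q"
  by (simp_all add: p_def q_def smooth_on_pd smooth_rho)

lemma smooth_P: "smooth_on U P" and smooth_Q: "smooth_on U Q"
  by (simp_all add: P_def Q_def smooth_on_pd smooth_p smooth_q)

lemma commute_Xu_Xv: "z \<in> U \<Longrightarrow> pd (1, 0) Xv z = pd (0, 1) Xu z"
  unfolding Xu_def Xv_def using U smooth_X by (rule pd_commute)

lemma commute_p_q: "z \<in> U \<Longrightarrow> pd (1, 0) q z = pd (0, 1) p z"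
  unfolding p_def q_def using U smooth_rho by (rule pd_commute)

lemma pd_eq_on:
  assumes "smooth_on U g" "z \<in> U" "\<And>x. x \<in> U \<Longrightarrow> g x = h x"
  shows "pd w g z = pd w h z"
  using assms U by (intro pd_cong[of U] smooth_on_differentiable[of U]) auto

context
  fixes z assumes z: "z \<in> U"
begin

text \<open>These come from differentiating the three relations of \<open>first_fundamental_form\<close> in both
  directions.\<close>

lemma tangential_parts:
  "pd (1, 0) Xu z \<bullet> Xu z = \<rho> z * p z" "pd (1, 0) Xu z \<bullet> Xv z = - \<rho> z * q z"
  "pd (0, 1) Xu z \<bullet> Xu z = \<rho> z * q z" "pd (0, 1) Xu z \<bullet> Xv z = \<rho> z * p z"
  "pd (0, 1) Xv z \<bullet> Xu z = - \<rho> z * p z" "pd (0, 1) Xv z \<bullet> Xv z = \<rho> z * q z"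
proof -
  have E: "pd w Xu z \<bullet> Xu z = \<rho> z * pd w \<rho> z" for w
    using pd_eq_on[OF smooth_on_inner[OF U smooth_Xu smooth_Xu] z, of "\<lambda>z. \<rho> z * \<rho> z" w] first_fundamental_form(1)
    by (simp add: pd_inner[OF smooth_Xu smooth_Xu z] pd_mult[OF smooth_rho smooth_rho z] inner_commute)
  have G: "pd w Xv z \<bullet> Xv z = \<rho> z * pd w \<rho> z" for w
    using pd_eq_on[OF smooth_on_inner[OF U smooth_Xv smooth_Xv] z, of "\<lambda>z. \<rho> z * \<rho> z" w] first_fundamental_form(2)
    by (simp add: pd_inner[OF smooth_Xv smooth_Xv z] pd_mult[OF smooth_rho smooth_rho z] inner_commute)
  have F: "pd w Xu z \<bullet> Xv z + pd w Xv z \<bullet> Xu z = 0" for w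
    using pd_constant_on[OF U z, of "\<lambda>z. Xu z \<bullet> Xv z" 0 w] first_fundamental_form(3)
    by (simp add: pd_inner[OF smooth_Xu smooth_Xv z] inner_commute)
  show 1: "pd (1, 0) Xu z \<bullet> Xu z = \<rho> z * p z" "pd (0, 1) Xu z \<bullet> Xu z = \<rho> z * q z"
    "pd (0, 1) Xv z \<bullet> Xv z = \<rho> z * q z"
    by (simp_all add: E G p_def q_def)
  show 2: "pd (0, 1) Xu z \<bullet> Xv z = \<rho> z * p z"
    using G[of "(1, 0)"] by (simp add: commute_Xu_Xv[OF z] p_def)
  show "pd (1, 0) Xu z \<bullet> Xv z = - \<rho> z * q z" "pd (0, 1) Xv z \<bullet> Xu z = - \<rho> z * p z"
    using F[of "(1, 0)"] F[of "(0, 1)"] 1 2 by (simp_all add: commute_Xu_Xv[OF z])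
qed

end

context
  fixes z assumes z: "z \<in> U"
begin

lemma weingarten:
  "pd (1, 0) N z \<bullet> Xu z = 1" "pd (1, 0) N z \<bullet> Xv z = 0" "pd (1, 0) N z \<bullet> N z = 0"
  "pd (0, 1) N z \<bullet> Xu z = 0" "pd (0, 1) N z \<bullet> Xv z = -1" "pd (0, 1) N z \<bullet> N z = 0"
proof -
  have n: "pd w N z \<bullet> N z = 0" for w
    using pd_constant_on[OF U z, of "\<lambda>z. N z \<bullet> N z" 1 w] normal_orthogonal(1)
    by (simp add: pd_inner[OF smooth_N smooth_N z] inner_commute)
  have u: "pd w N z \<bullet> Xu z = - (pd w Xu z \<bullet> N z)" for w
    using pd_constant_on[OF U z, of "\<lambda>z. N z \<bullet> Xu z" 0 w] normal_orthogonal(2)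
    by (simp add: pd_inner[OF smooth_N smooth_Xu z] inner_commute)
  have v: "pd w N z \<bullet> Xv z = - (pd w Xv z \<bullet> N z)" for w
    using pd_constant_on[OF U z, of "\<lambda>z. N z \<bullet> Xv z" 0 w] normal_orthogonal(3)
    by (simp add: pd_inner[OF smooth_N smooth_Xv z] inner_commute)
  show "pd (1, 0) N z \<bullet> Xu z = 1" "pd (1, 0) N z \<bullet> Xv z = 0" "pd (1, 0) N z \<bullet> N z = 0"
    "pd (0, 1) N z \<bullet> Xu z = 0" "pd (0, 1) N z \<bullet> Xv z = -1" "pd (0, 1) N z \<bullet> N z = 0"
    by (simp_all add: n u v second_fundamental_form[OF z] commute_Xu_Xv[OF z])
qed

lemma structure_equations:
  "pd (1, 0) Xu z = p z *\<^sub>R e z - q z *\<^sub>R f z - N z"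
  "pd (0, 1) Xu z = q z *\<^sub>R e z + p z *\<^sub>R f z"
  "pd (0, 1) Xv z = - p z *\<^sub>R e z + q z *\<^sub>R f z + N z"
  "pd (1, 0) N z = (1 / \<rho> z) *\<^sub>R e z"
  "pd (0, 1) N z = - (1 / \<rho> z) *\<^sub>R f z"
proof -
  have X: "x = ((x \<bullet> Xu z) / \<rho> z) *\<^sub>R e z + ((x \<bullet> Xv z) / \<rho> z) *\<^sub>R f z + (x \<bullet> N z) *\<^sub>R N z" for x
    using orthonormal3_expand[OF orthonormal[OF z], of x] rho_pos[OF z]
    by (simp add: Xu_eq[OF z] Xv_eq[OF z])
  note s = tangential_parts[OF z] weingarten second_fundamental_form[OF z]
  show "pd (1, 0) Xu z = p z *\<^sub>R e z - q z *\<^sub>R f z - N z"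
    "pd (0, 1) Xu z = q z *\<^sub>R e z + p z *\<^sub>R f z"
    "pd (0, 1) Xv z = - p z *\<^sub>R e z + q z *\<^sub>R f z + N z"
    "pd (1, 0) N z = (1 / \<rho> z) *\<^sub>R e z"
    "pd (0, 1) N z = - (1 / \<rho> z) *\<^sub>R f z"
    using X[of "pd (1, 0) Xu z"] X[of "pd (0, 1) Xu z"] X[of "pd (0, 1) Xv z"]
      X[of "pd (1, 0) N z"] X[of "pd (0, 1) N z"] rho_pos[OF z]
    unfolding s by simp_all
qed

end

text \<open>The \<open>X\<^sub>v\<close>-component of the integrability condition \<open>(X\<^sub>u\<^sub>u)\<^sub>v = (X\<^sub>u\<^sub>v)\<^sub>u\<close>.\<close>

lemma gauss_equation:
  assumes z: "z \<in> U"
  shows "\<rho> z * (P z + Q z) - (p z)\<^sup>2 - (q z)\<^sup>2 = 1"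
proof -
  let ?A = "pd (1, 0) Xu" and ?B = "pd (0, 1) Xu" and ?C = "pd (0, 1) Xv"
  have A: "smooth_on U ?A" and B: "smooth_on U ?B"
    by (simp_all add: smooth_on_pd smooth_Xu)
  have "?A z \<bullet> ?C z + pd (0, 1) ?A z \<bullet> Xv z = pd (0, 1) (\<lambda>z. ?A z \<bullet> Xv z) z"
    by (simp add: pd_inner[OF A smooth_Xv z])
  also have "\<dots> = pd (0, 1) (\<lambda>z. - (\<rho> z * q z)) z"
    by (rule pd_eq_on[OF smooth_on_inner[OF U A smooth_Xv] z]) (simp add: tangential_parts)
  also have "\<dots> = - pd (0, 1) (\<lambda>z. \<rho> z * q z) z"
    by (intro pd_eqI has_derivative_minus smooth_on_has_derivative[OF smooth_on_mult[OF U]]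
        smooth_rho smooth_q z)
  also have "\<dots> = - (\<rho> z * Q z + q z * q z)"
    by (simp add: pd_mult[OF smooth_rho smooth_q z] Q_def flip: q_def)
  finally have 1: "?A z \<bullet> ?C z + pd (0, 1) ?A z \<bullet> Xv z = - (\<rho> z * Q z + q z * q z)" .
  have "?B z \<bullet> ?B z + pd (1, 0) ?B z \<bullet> Xv z = pd (1, 0) (\<lambda>z. ?B z \<bullet> Xv z) z"
    by (simp add: pd_inner[OF B smooth_Xv z] commute_Xu_Xv[OF z])
  also have "\<dots> = pd (1, 0) (\<lambda>z. \<rho> z * p z) z"
    by (rule pd_eq_on[OF smooth_on_inner[OF U B smooth_Xv] z]) (simp add: tangential_parts)
  also have "\<dots> = \<rho> z * P z + p z * p z"
    by (simp add: pd_mult[OF smooth_rho smooth_p z] P_def flip: p_def)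
  finally have 2: "?B z \<bullet> ?B z + pd (1, 0) ?B z \<bullet> Xv z = \<rho> z * P z + p z * p z" .
  have "pd (0, 1) ?A z = pd (1, 0) ?B z"
    using U smooth_Xu z by (rule pd_commute)
  moreover have "?A z \<bullet> ?C z = - p z * p z - q z * q z - 1" "?B z \<bullet> ?B z = q z * q z + p z * p z"
    using orthonormal[OF z] unfolding structure_equations[OF z] orthonormal3_def
    by (simp_all add: inner_simps inner_commute)
  ultimately show ?thesis using 1 2 by (simp add: algebra_simps power2_eq_square)
qed

lemma adapted_frame:
  "isothermic_frame U \<rho> p q X e f N"
  unfolding isothermic_frame_def
proof (rule ballI, goal_cases)
  case z: (1 z)
  note r = rho_pos[OF z] 
  note s = structure_equations[OF z] Xu_eq[OF z] Xv_eq[OF z]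
  have d\<rho>: "(\<rho> has_derivative (\<lambda>w. fst w * p z + snd w * q z)) (at z)"
    using smooth_on_has_derivative_coords[OF smooth_rho z] by (simp add: p_def q_def)
  have dinv: "((\<lambda>x. 1 / \<rho> x) has_derivative (\<lambda>w. - ((fst w * p z / \<rho> z + snd w * q z / \<rho> z) / \<rho> z))) (at z)"
    using r by (auto intro!: derivative_eq_intros d\<rho> simp: field_simps fun_eq_iff)
  have dXu: "(Xu has_derivative (\<lambda>w. fst w *\<^sub>R pd (1, 0) Xu z + snd w *\<^sub>R pd (0, 1) Xu z)) (at z)"
    by (rule smooth_on_has_derivative_coords[OF smooth_Xu z])
  have dXv: "(Xv has_derivative (\<lambda>w. fst w *\<^sub>R pd (0, 1) Xu z + snd w *\<^sub>R pd (0, 1) Xv z)) (at z)"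
    using smooth_on_has_derivative_coords[OF smooth_Xv z] by (simp add: commute_Xu_Xv[OF z])
  have "(e has_derivative (\<lambda>w. fst w *\<^sub>R (- (q z / \<rho> z) *\<^sub>R f z - (1 / \<rho> z) *\<^sub>R N z)
                          + snd w *\<^sub>R ((p z / \<rho> z) *\<^sub>R f z))) (at z)"
    unfolding e_def[abs_def]
    by (rule has_derivative_eq_rhs[OF has_derivative_scaleR[OF dinv dXu]])
       (use r in \<open>simp add: fun_eq_iff s algebra_simps add_divide_distrib flip: e_def f_def\<close>)
  moreover have "(f has_derivative (\<lambda>w. fst w *\<^sub>R ((q z / \<rho> z) *\<^sub>R e z)
                          + snd w *\<^sub>R (- (p z / \<rho> z) *\<^sub>R e z + (1 / \<rho> z) *\<^sub>R N z))) (at z)"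
    unfolding f_def[abs_def]
    by (rule has_derivative_eq_rhs[OF has_derivative_scaleR[OF dinv dXv]])
       (use r in \<open>simp add: fun_eq_iff s algebra_simps add_divide_distrib flip: e_def f_def\<close>)
  moreover have "(N has_derivative (\<lambda>w. fst w *\<^sub>R ((1 / \<rho> z) *\<^sub>R e z) - snd w *\<^sub>R ((1 / \<rho> z) *\<^sub>R f z))) (at z)"
    using smooth_on_has_derivative_coords[OF smooth_N z] by (simp add: s)
  moreover have "(X has_derivative (\<lambda>w. (fst w * \<rho> z) *\<^sub>R e z + (snd w * \<rho> z) *\<^sub>R f z)) (at z)"
    using smooth_on_has_derivative_coords[OF smooth_X z] by (simp add: s flip: Xu_def Xv_def)
  ultimately show ?case
    using d\<rho> r orthonormal[OF z] by (intro conjI)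
qed

end

section \<open>Planar curvature lines\<close>

text \<open>The closed linear system for \<open>\<rho>\<close>, \<open>p = \<rho>\<^sub>u\<close>, \<open>q = \<rho>\<^sub>v\<close>, \<open>P = \<rho>\<^sub>u\<^sub>u\<close>, in which
  \<open>P - c \<rho>\<close> stands for \<open>\<rho>\<^sub>v\<^sub>v\<close>, together with the Gauss equation.\<close>

definition profile_system ::
  "(real \<times> real) set \<Rightarrow> (real \<times> real \<Rightarrow> real) \<Rightarrow> (real \<times> real \<Rightarrow> real) \<Rightarrow> (real \<times> real \<Rightarrow> real) \<Rightarrow>
   (real \<times> real \<Rightarrow> real) \<Rightarrow> real \<Rightarrow> bool" where
  "profile_system U \<rho> p q P c \<longleftrightarrow> (\<forall>z\<in>U.
     \<rho> z > 0 \<and>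
     (\<rho> has_derivative (\<lambda>w. fst w * p z + snd w * q z)) (at z) \<and>
     (p has_derivative (\<lambda>w. fst w * P z)) (at z) \<and>
     (q has_derivative (\<lambda>w. snd w * (P z - c * \<rho> z))) (at z) \<and>
     (P has_derivative (\<lambda>w. fst w * (c * p z))) (at z) \<and>
     \<rho> z * (2 * P z - c * \<rho> z) - (p z)\<^sup>2 - (q z)\<^sup>2 = 1)"

context isothermic_minimal_surface
begin

lemma u_line_in_plane:
  assumes planar: "planar_curvature_lines_on U X N" and z: "z \<in> U"
  shows "\<exists>a b \<epsilon>. a \<noteq> 0 \<and> \<epsilon> > 0 \<and>
    (\<forall>s\<in>{-\<epsilon><..<\<epsilon>}. z + s *\<^sub>R (1, 0) \<in> U \<and> a \<bullet> X (z + s *\<^sub>R (1, 0)) = b)"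
proof -
  obtain \<epsilon> where \<epsilon>: "\<epsilon> > 0" "ball z \<epsilon> \<subseteq> U"
    using U z open_contains_ball by blast
  let ?I = "{-\<epsilon><..<\<epsilon>}" and ?\<gamma> = "\<lambda>s::real. z + s *\<^sub>R (1, 0)"
  have line: "?\<gamma> s \<in> U" if "s \<in> ?I" for s
    using that \<epsilon> by (auto simp: subset_eq dist_norm norm_Pair)
  have D: "(?\<gamma> has_vector_derivative (1, 0)) (at s)" for s
    by (auto intro!: derivative_eq_intros)
  have "?\<gamma> C1_differentiable_on ?I"
    unfolding C1_differentiable_on_def by (intro exI[of _ "\<lambda>_. (1, 0)"]) (use D in auto)
  moreover have "vector_derivative ?\<gamma> (at s) = (1, 0)" for s
    using D by (rule vector_derivative_at)
  ultimately have "curvature_line_on U X N ?I ?\<gamma>"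
    using curvature_lines line
    by (auto simp: curvature_line_on_def curvature_line_coordinates_on_def is_interval_convex_1)
  then have "in_some_plane ((X \<circ> ?\<gamma>) ` ?I)"
    using planar unfolding planar_curvature_lines_on_def by blast
  then obtain a b where "a \<noteq> 0" "(X \<circ> ?\<gamma>) ` ?I \<subseteq> {x. a \<bullet> x = b}"
    unfolding in_some_plane_def by blast
  then have "a \<noteq> 0" "\<And>s. s \<in> ?I \<Longrightarrow> a \<bullet> X (?\<gamma> s) = b" by (auto simp: image_subset_iff)
  then show ?thesis using \<epsilon>(1) line
    by (intro exI[of _ a] exI[of _ b] exI[of _ \<epsilon>]) simp
qed

lemma smooth_f: "smooth_on U f"
proof -
  have "smooth_on U (\<lambda>z. 1 / \<rho> z)"
    unfolding smooth_on_def
  proof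
    fix n
    have "higher_differentiable_on U (\<lambda>z. \<rho> z powr (-1)) n"
      using smooth_rho rho_pos U unfolding smooth_on_def by (blast intro: higher_differentiable_on_powr)
    moreover have "\<rho> z powr (-1) = 1 / \<rho> z" if "z \<in> U" for z
      using rho_pos[OF that] by (simp add: powr_minus divide_inverse)
    ultimately show "higher_differentiable_on U (\<lambda>z. 1 / \<rho> z) n"
      by (rule higher_differentiable_on_cong[OF U, rotated])
  qed
  then show ?thesis
    unfolding f_def[abs_def] by (intro smooth_on_scaleR U smooth_Xv)
qed

text \<open>Let \<open>a\<close> be the normal of the plane of the \<open>u\<close>-curve. Along the curve \<open>a\<close> is orthogonal to
  \<open>e\<close> and to \<open>X\<^sub>u\<^sub>u = p e - q f - N\<close>, so \<open>q (a \<bullet> f) + a \<bullet> N = 0\<close> there. In the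
  \<open>u\<close>-derivative of this relation \<open>f\<^sub>u\<close> and \<open>N\<^sub>u\<close> are multiples of \<open>e\<close> and drop out, which
  leaves \<open>q\<^sub>u (a \<bullet> f) = 0\<close>. Finally \<open>a \<bullet> f = 0\<close> is impossible, as it would force
  \<open>a \<bullet> N = 0\<close> and hence \<open>a = 0\<close>.\<close>

lemma mixed_derivative_zero:
  assumes planar: "planar_curvature_lines_on U X N" and z: "z \<in> U"
  shows "pd (1, 0) q z = 0"
proof -
  obtain a b \<epsilon> where a: "a \<noteq> 0" and \<epsilon>: "\<epsilon> > 0"
    and line: "\<And>s. s \<in> {-\<epsilon><..<\<epsilon>} \<Longrightarrow> z + s *\<^sub>R (1, 0) \<in> U"
    and plane: "\<And>s. s \<in> {-\<epsilon><..<\<epsilon>} \<Longrightarrow> a \<bullet> X (z + s *\<^sub>R (1, 0)) = b"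
    using u_line_in_plane[OF planar z] by blast
  have sm: "smooth_on U (\<lambda>x. a \<bullet> g x)" if "smooth_on U g" for g :: "real \<times> real \<Rightarrow> real^3"
    by (intro smooth_on_inner smooth_on_const U that)
  have d: "pd w (\<lambda>x. a \<bullet> g x) y = a \<bullet> pd w g y" if "smooth_on U g" "y \<in> U" for w y and g :: "real \<times> real \<Rightarrow> real^3"
    using pd_inner_const[OF that, of w a] by (simp add: inner_commute)
  note zero = pd_zero_on_line[where U = U and I = "{-\<epsilon><..<\<epsilon>}" and z = z and w = "(1, 0)", OF _ _ _ line]
  have Xu0: "a \<bullet> Xu (z + s *\<^sub>R (1, 0)) = 0" if "s \<in> {-\<epsilon><..<\<epsilon>}" for s
    using zero[OF sm[OF smooth_X], of s b] that plane line by (simp add: d[OF smooth_X] Xu_def)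
  have Xuu0: "a \<bullet> pd (1, 0) Xu (z + s *\<^sub>R (1, 0)) = 0" if "s \<in> {-\<epsilon><..<\<epsilon>}" for s
    using zero[OF sm[OF smooth_Xu], of s 0] that Xu0 line by (simp add: d[OF smooth_Xu])
  have e0: "a \<bullet> e x = 0" if "a \<bullet> Xu x = 0" for x
    using that by (simp add: e_def)
  let ?g = "\<lambda>x. q x * (a \<bullet> f x) + a \<bullet> N x"
  have g0: "?g (z + s *\<^sub>R (1, 0)) = 0" if "s \<in> {-\<epsilon><..<\<epsilon>}" for s
    using Xuu0[OF that] e0[OF Xu0[OF that]] structure_equations(1)[OF line[OF that]]
    by (simp add: inner_simps)
  have smg: "smooth_on U ?g"
    by (intro smooth_on_add smooth_on_mult sm U smooth_q smooth_f smooth_N)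
  have "pd (1, 0) ?g (z + 0 *\<^sub>R (1, 0)) = 0"
    by (rule zero[OF smg, of 0 0]) (use \<epsilon> g0 in auto)
  then have dg: "pd (1, 0) ?g z = 0" by (simp flip: zero_prod_def)
  have z0: "a \<bullet> e z = 0" "q z * (a \<bullet> f z) + a \<bullet> N z = 0"
    using e0[OF Xu0[of 0]] g0[of 0] \<epsilon> by (simp_all flip: zero_prod_def)
  have "(f has_derivative (\<lambda>w. fst w *\<^sub>R ((q z / \<rho> z) *\<^sub>R e z)
      + snd w *\<^sub>R (- (p z / \<rho> z) *\<^sub>R e z + (1 / \<rho> z) *\<^sub>R N z))) (at z)"
    using adapted_frame z by (simp add: isothermic_frame_def)
  from pd_eqI[OF this, of "(1, 0)"] have "pd (1, 0) f z = (q z / \<rho> z) *\<^sub>R e z"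
    by simp
  then have "pd (1, 0) ?g z = q z * 0 + pd (1, 0) q z * (a \<bullet> f z) + 0"
    using pd_eqI[OF has_derivative_add[OF smooth_on_has_derivative[OF smooth_on_mult[OF U smooth_q sm[OF smooth_f]] z]
        smooth_on_has_derivative[OF sm[OF smooth_N] z]], of "(1,0)"]
    by (simp add: pd_mult[OF smooth_q sm[OF smooth_f] z] d[OF smooth_f z] d[OF smooth_N z]
       structure_equations[OF z] z0)
  moreover have "a \<bullet> f z \<noteq> 0"
  proof
    assume "a \<bullet> f z = 0"
    then have "a = 0"
      using z0 orthonormal3_expand[OF orthonormal[OF z], of a] by simp
    then show False using a by simp
  qed
  ultimately show ?thesis using dg by simp
qed

text \<open>Since \<open>\<rho>\<^sub>u\<^sub>v = 0\<close>, the two partial derivatives of the Gauss equation express \<open>\<rho>\<^sub>u\<^sub>u\<^sub>u\<close> and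
  \<open>\<rho>\<^sub>v\<^sub>v\<^sub>v\<close> through lower derivatives, and with these values the gradient of
  \<open>(\<rho>\<^sub>u\<^sub>u - \<rho>\<^sub>v\<^sub>v) / \<rho>\<close> vanishes.\<close>

lemma exists_profile_system:
  assumes planar: "planar_curvature_lines_on U X N" and con: "connected U"
  obtains c where "profile_system U \<rho> p q P c"
proof -
  have q1: "pd (1, 0) q z = 0" and p2: "pd (0, 1) p z = 0" if "z \<in> U" for z
    using mixed_derivative_zero[OF planar that] commute_p_q[OF that] by auto
  have P2: "pd (0, 1) P z = 0" if z: "z \<in> U" for z
    using pd_commute[OF U smooth_p z, where w = "(0, 1)" and w' = "(1, 0)"] pd_constant_on[OF U z, of "pd (0, 1) p" 0 "(1, 0)"] p2
    by (simp add: P_def)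
  have Q1: "pd (1, 0) Q z = 0" if z: "z \<in> U" for z
    using pd_commute[OF U smooth_q z, where w = "(0, 1)" and w' = "(1, 0)"] pd_constant_on[OF U z, of "pd (1, 0) q" 0 "(0, 1)"] q1
    by (simp add: Q_def)
  have dp: "(p has_derivative (\<lambda>w. fst w * P z)) (at z)"
    and dq: "(q has_derivative (\<lambda>w. snd w * Q z)) (at z)"
    and dP: "(P has_derivative (\<lambda>w. fst w * pd (1, 0) P z)) (at z)"
    and dQ: "(Q has_derivative (\<lambda>w. snd w * pd (0, 1) Q z)) (at z)"
    and d\<rho>: "(\<rho> has_derivative (\<lambda>w. fst w * p z + snd w * q z)) (at z)" if z: "z \<in> U" for z
    using smooth_on_has_derivative_coords[OF smooth_p z] smooth_on_has_derivative_coords[OF smooth_q z]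
      smooth_on_has_derivative_coords[OF smooth_P z] smooth_on_has_derivative_coords[OF smooth_Q z]
      smooth_on_has_derivative_coords[OF smooth_rho z]
    by (simp_all add: p2[OF z] q1[OF z] P2[OF z] Q1[OF z] P_def[symmetric] Q_def[symmetric]
        p_def[symmetric] q_def[symmetric])
  have third: "\<rho> z * pd (1, 0) P z = p z * (P z - Q z)" "\<rho> z * pd (0, 1) Q z = q z * (Q z - P z)"
    if z: "z \<in> U" for z
  proof -
    let ?G = "\<lambda>z. \<rho> z * (P z + Q z) - (p z)\<^sup>2 - (q z)\<^sup>2"
    have "(?G has_derivative (\<lambda>w. \<rho> z * (fst w * pd (1, 0) P z + snd w * pd (0, 1) Q z)
        + (fst w * p z + snd w * q z) * (P z + Q z) - 2 * p z * (fst w * P z) - 2 * q z * (snd w * Q z))) (at z)"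
      by (auto intro!: derivative_eq_intros dp[OF z] dq[OF z] dP[OF z] dQ[OF z] d\<rho>[OF z])
    moreover have "(?G has_derivative (\<lambda>w. 0)) (at z)"
      by (rule has_derivative_transform_within_open[OF _ U z, of "\<lambda>s. 1"]) (simp_all add: gauss_equation)
    ultimately have "(\<lambda>w. \<rho> z * (fst w * pd (1, 0) P z + snd w * pd (0, 1) Q z)
        + (fst w * p z + snd w * q z) * (P z + Q z) - 2 * p z * (fst w * P z) - 2 * q z * (snd w * Q z)) = (\<lambda>w. 0)"
      by (rule has_derivative_unique)
    from fun_cong[OF this, of "(1, 0)"] fun_cong[OF this, of "(0, 1)"]
    show "\<rho> z * pd (1, 0) P z = p z * (P z - Q z)" "\<rho> z * pd (0, 1) Q z = q z * (Q z - P z)"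
      by (simp_all add: algebra_simps)
  qed
  have const: "((\<lambda>z. (P z - Q z) / \<rho> z) has_derivative (\<lambda>w. 0)) (at z)" if z: "z \<in> U" for z
  proof -
    have r: "\<rho> z \<noteq> 0" using rho_pos[OF z] by simp
    have eq: "pd (1, 0) P z = p z * (P z - Q z) / \<rho> z" "pd (0, 1) Q z = q z * (Q z - P z) / \<rho> z"
      using third[OF z] r by (simp_all add: field_simps)
    show ?thesis
      using r by (auto intro!: derivative_eq_intros dP[OF z, unfolded eq] dQ[OF z, unfolded eq] d\<rho>[OF z]
          simp: fun_eq_iff field_simps)
  qed
  obtain c where c': "(P z - Q z) / \<rho> z = c" if "z \<in> U" for z
    using has_derivative_zero_unique_connected[OF U con const] by metis
  then have c: "Q z = P z - c * \<rho> z" if "z \<in> U" for z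
    using c'[OF that] rho_pos[OF that] by (simp add: field_simps)
  have "pd (1, 0) P z = c * p z" if z: "z \<in> U" for z
    using third(1)[OF z] rho_pos[OF z] by (simp add: c[OF z])
  moreover have "\<rho> z * (2 * P z - c * \<rho> z) - (p z)\<^sup>2 - (q z)\<^sup>2 = 1" if z: "z \<in> U" for z
    using gauss_equation[OF z] unfolding c[OF z] by (simp add: algebra_simps)
  ultimately have "profile_system U \<rho> p q P c"
    unfolding profile_system_def
    using rho_pos d\<rho> dp dq dP c by simp
  then show thesis by (rule that)
qed

end

section \<open>The model surfaces\<close>

lemma vector_3_eq: "(vector [a, b, c] :: real^3) = a *\<^sub>R axis 1 1 + b *\<^sub>R axis 2 1 + c *\<^sub>R axis 3 1"
  by (simp add: vec_eq_iff forall_3 axis_def)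

lemma has_derivative_vector_3:
  assumes "(f has_derivative f') F" "(g has_derivative g') F" "(h has_derivative h') F"
  shows "((\<lambda>z. vector [f z, g z, h z] :: real^3) has_derivative (\<lambda>w. vector [f' w, g' w, h' w])) F"
  unfolding vector_3_eq by (intro derivative_intros assms)

text \<open>The frames of the models have a common denominator \<open>D\<close>, a constant multiple of \<open>\<rho>\<close>. Clearing
  it turns the structure equations into polynomial identities in the numerators.\<close>

lemma isothermic_frame_quotient:
  fixes X E F G Eu Ev Fu Fv Gu Gv :: "real \<times> real \<Rightarrow> real^3" and \<alpha> \<beta> D :: "real \<times> real \<Rightarrow> real"
  assumes \<gamma>: "\<gamma> > 0" and D: "\<And>z. D z > 0"
    and dD: "\<And>z. (D has_derivative (\<lambda>w. fst w * \<alpha> z + snd w * \<beta> z)) (at z)"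
    and dX: "\<And>z. (X has_derivative (\<lambda>w. (fst w / \<gamma>) *\<^sub>R E z + (snd w / \<gamma>) *\<^sub>R F z)) (at z)"
    and dE: "\<And>z. (E has_derivative (\<lambda>w. fst w *\<^sub>R Eu z + snd w *\<^sub>R Ev z)) (at z)"
    and dF: "\<And>z. (F has_derivative (\<lambda>w. fst w *\<^sub>R Fu z + snd w *\<^sub>R Fv z)) (at z)"
    and dG: "\<And>z. (G has_derivative (\<lambda>w. fst w *\<^sub>R Gu z + snd w *\<^sub>R Gv z)) (at z)"
    and o: "\<And>z. E z \<bullet> E z = D z * D z" "\<And>z. F z \<bullet> F z = D z * D z" "\<And>z. G z \<bullet> G z = D z * D z"
      "\<And>z. E z \<bullet> F z = 0" "\<And>z. E z \<bullet> G z = 0" "\<And>z. F z \<bullet> G z = 0"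
    and Eu: "\<And>z. D z *\<^sub>R Eu z - \<alpha> z *\<^sub>R E z = - \<beta> z *\<^sub>R F z - \<gamma> *\<^sub>R G z"
    and Ev: "\<And>z. D z *\<^sub>R Ev z - \<beta> z *\<^sub>R E z = \<alpha> z *\<^sub>R F z"
    and Fu: "\<And>z. D z *\<^sub>R Fu z - \<alpha> z *\<^sub>R F z = \<beta> z *\<^sub>R E z"
    and Fv: "\<And>z. D z *\<^sub>R Fv z - \<beta> z *\<^sub>R F z = - \<alpha> z *\<^sub>R E z + \<gamma> *\<^sub>R G z"
    and Gu: "\<And>z. D z *\<^sub>R Gu z - \<alpha> z *\<^sub>R G z = \<gamma> *\<^sub>R E z"
    and Gv: "\<And>z. D z *\<^sub>R Gv z - \<beta> z *\<^sub>R G z = - \<gamma> *\<^sub>R F z"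
  shows "isothermic_frame UNIV (\<lambda>z. D z / \<gamma>) (\<lambda>z. \<alpha> z / \<gamma>) (\<lambda>z. \<beta> z / \<gamma>) X
    (\<lambda>z. (1 / D z) *\<^sub>R E z) (\<lambda>z. (1 / D z) *\<^sub>R F z) (\<lambda>z. (1 / D z) *\<^sub>R G z)"
  unfolding isothermic_frame_def
proof (rule ballI, goal_cases)
  case (1 z)
  have D0: "D z \<noteq> 0" using D[of z] by simp
  have quot: "((\<lambda>z. (1 / D z) *\<^sub>R H z) has_derivative
      (\<lambda>w. fst w *\<^sub>R ((1 / (D z * D z)) *\<^sub>R (D z *\<^sub>R Hu - \<alpha> z *\<^sub>R H z))
         + snd w *\<^sub>R ((1 / (D z * D z)) *\<^sub>R (D z *\<^sub>R Hv - \<beta> z *\<^sub>R H z)))) (at z)"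
    if dH: "(H has_derivative (\<lambda>w. fst w *\<^sub>R Hu + snd w *\<^sub>R Hv)) (at z)" for H :: "real \<times> real \<Rightarrow> real^3" and Hu Hv
  proof -
    have "((\<lambda>z. 1 / D z) has_derivative (\<lambda>w. - (fst w * \<alpha> z + snd w * \<beta> z) / (D z * D z))) (at z)"
      using D0 by (auto intro!: derivative_eq_intros dD simp: field_simps)
    from has_derivative_scaleR[OF this dH] show ?thesis
      by (rule has_derivative_eq_rhs)
         (use D0 in \<open>simp add: fun_eq_iff algebra_simps add_divide_distrib diff_divide_distrib\<close>)
  qed
  note dE' = quot[OF dE, unfolded Eu Ev] and dF' = quot[OF dF, unfolded Fu Fv]
    and dG' = quot[OF dG, unfolded Gu Gv]
  let ?e = "(1 / D z) *\<^sub>R E z" and ?f = "(1 / D z) *\<^sub>R F z" and ?n = "(1 / D z) *\<^sub>R G z"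
    and ?r = "D z / \<gamma>" and ?p = "\<alpha> z / \<gamma>" and ?q = "\<beta> z / \<gamma>"
  have "orthonormal3 ?e ?f ?n"
    using D0 by (simp add: orthonormal3_def o)
  moreover have "((\<lambda>z. D z / \<gamma>) has_derivative (\<lambda>w. fst w * ?p + snd w * ?q)) (at z)"
    using \<gamma> by (auto intro!: derivative_eq_intros dD simp: field_simps)
  moreover have "(X has_derivative (\<lambda>w. (fst w * ?r) *\<^sub>R ?e + (snd w * ?r) *\<^sub>R ?f)) (at z)"
    by (rule has_derivative_eq_rhs[OF dX]) (use D0 in simp)
  moreover have "((\<lambda>z. (1 / D z) *\<^sub>R E z) has_derivative
      (\<lambda>w. fst w *\<^sub>R (- (?q / ?r) *\<^sub>R ?f - (1 / ?r) *\<^sub>R ?n) + snd w *\<^sub>R ((?p / ?r) *\<^sub>R ?f))) (at z)"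
    by (rule has_derivative_eq_rhs[OF dE']) (use D0 \<gamma> in \<open>simp add: fun_eq_iff algebra_simps\<close>)
  moreover have "((\<lambda>z. (1 / D z) *\<^sub>R F z) has_derivative
      (\<lambda>w. fst w *\<^sub>R ((?q / ?r) *\<^sub>R ?e) + snd w *\<^sub>R (- (?p / ?r) *\<^sub>R ?e + (1 / ?r) *\<^sub>R ?n))) (at z)"
    by (rule has_derivative_eq_rhs[OF dF']) (use D0 \<gamma> in \<open>simp add: fun_eq_iff algebra_simps\<close>)
  moreover have "((\<lambda>z. (1 / D z) *\<^sub>R G z) has_derivative
      (\<lambda>w. fst w *\<^sub>R ((1 / ?r) *\<^sub>R ?e) - snd w *\<^sub>R ((1 / ?r) *\<^sub>R ?f))) (at z)"
    by (rule has_derivative_eq_rhs[OF dG']) (use D0 \<gamma> in \<open>simp add: fun_eq_iff algebra_simps\<close>)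
  moreover have "0 < ?r" using D[of z] \<gamma> by simp
  ultimately show ?case
    by (intro conjI)
qed

lemma scaleR_vector_3: "r *\<^sub>R (vector [a, b, c] :: real^3) = vector [r * a, r * b, r * c]"
  and add_vector_3: "(vector [a, b, c] :: real^3) + vector [a', b', c'] = vector [a + a', b + b', c + c']"
  and diff_vector_3: "(vector [a, b, c] :: real^3) - vector [a', b', c'] = vector [a - a', b - b', c - c']"
  and minus_vector_3: "- (vector [a, b, c] :: real^3) = vector [- a, - b, - c]"
  and inner_vector_3: "(vector [a, b, c] :: real^3) \<bullet> vector [a', b', c'] = a * a' + b * b' + c * c'"
  and vector_3_eq_iff: "(vector [a, b, c] :: real^3) = vector [a', b', c'] \<longleftrightarrow> a = a' \<and> b = b' \<and> c = c'"
  by (auto simp: vec_eq_iff forall_3 inner_vec_def sum_3)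

lemmas vector_3_simps = scaleR_vector_3 add_vector_3 diff_vector_3 minus_vector_3 inner_vector_3 vector_3_eq_iff

lemma has_derivative_sinh_fst: "((\<lambda>z. sinh (k * fst z)) has_derivative (\<lambda>w. fst w * (k * cosh (k * fst z)))) (at (z :: real \<times> real))"
  and has_derivative_cosh_fst: "((\<lambda>z. cosh (k * fst z)) has_derivative (\<lambda>w. fst w * (k * sinh (k * fst z)))) (at (z :: real \<times> real))"
  and has_derivative_sin_snd: "((\<lambda>z. sin (k * snd z)) has_derivative (\<lambda>w. snd w * (k * cos (k * snd z)))) (at (z :: real \<times> real))"
  and has_derivative_cos_snd: "((\<lambda>z. cos (k * snd z)) has_derivative (\<lambda>w. - snd w * (k * sin (k * snd z)))) (at (z :: real \<times> real))"
  for k :: real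
proof -
  have 1: "((\<lambda>z. k * fst z) has_derivative (\<lambda>w. k * fst w)) (at z)" 
    and 2: "((\<lambda>z. k * snd z) has_derivative (\<lambda>w. k * snd w)) (at z)" for z :: "real \<times> real"
    by (auto intro!: derivative_eq_intros)
  note chain = DERIV_compose_FDERIV[THEN has_derivative_eq_rhs]
  show "((\<lambda>z. sinh (k * fst z)) has_derivative (\<lambda>w. fst w * (k * cosh (k * fst z)))) (at (z :: real \<times> real))"
    by (rule chain[OF has_field_derivative_sinh[OF DERIV_ident] 1]) (simp add: fun_eq_iff)
  show "((\<lambda>z. cosh (k * fst z)) has_derivative (\<lambda>w. fst w * (k * sinh (k * fst z)))) (at (z :: real \<times> real))"
    by (rule chain[OF has_field_derivative_cosh[OF DERIV_ident] 1]) (simp add: fun_eq_iff)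
  show "((\<lambda>z. sin (k * snd z)) has_derivative (\<lambda>w. snd w * (k * cos (k * snd z)))) (at (z :: real \<times> real))"
    by (rule chain[OF DERIV_sin 2]) (simp add: fun_eq_iff)
  show "((\<lambda>z. cos (k * snd z)) has_derivative (\<lambda>w. - snd w * (k * sin (k * snd z)))) (at (z :: real \<times> real))"
    by (rule chain[OF DERIV_cos 2]) (simp add: fun_eq_iff)
qed

text \<open>The surface \<open>X\<^sup>\<theta>\<close> with \<open>C = cos \<theta>\<close> and \<open>S = sin \<theta>\<close>. The adapted frame depends only on the
  relation \<open>C\<^sup>2 - S\<^sup>2 = k\<^sup>2\<close>, so \<open>C\<close> and \<open>S\<close> are kept as parameters.\<close>

definition hyperbolic_model :: "real \<Rightarrow> real \<Rightarrow> real \<Rightarrow> real \<times> real \<Rightarrow> real^3" where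
  "hyperbolic_model k C S = (\<lambda>(u, v). vector
     [(k * u * C - S * sinh (k * u) * cos (k * v)) / k ^ 3,
      (k * v * S - C * cosh (k * u) * sin (k * v)) / k ^ 3,
      (cosh (k * u) * cos (k * v) - 1) / k\<^sup>2])"

text \<open>The numerators \<open>E\<close> and \<open>F\<close> are \<open>k\<^sup>2 X\<^sub>u\<close> and \<open>k\<^sup>2 X\<^sub>v\<close>. The numerator \<open>G\<close> of the normal
  comes from \<open>E \<times> F = D G\<close>: the cross product contains the factor
  \<open>D = C cosh(ku) - S cos(kv)\<close>, which is positive since \<open>\<bar>S\<bar> < C\<close>.\<close>

lemma hyperbolic_model_frame:
  assumes k: "k > 0" and C: "C > 0" and CS: "C\<^sup>2 - S\<^sup>2 = k\<^sup>2"
  shows "\<exists>p q e f n. isothermic_frame UNIV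
    (\<lambda>z. (C * cosh (k * fst z) - S * cos (k * snd z)) / k\<^sup>2) p q (hyperbolic_model k C S) e f n"
proof -
  have SC: "\<bar>S\<bar> < C"
  proof -
    have "S\<^sup>2 < C\<^sup>2" using CS k by (smt (verit) zero_less_power)
    then show ?thesis using C by (metis abs_of_pos power2_abs power_less_imp_less_base less_imp_le)
  qed
  have D: "C * cosh (k * u) - S * cos (k * v) > 0" for u v
  proof -
    have "S * cos (k * v) \<le> \<bar>S\<bar>"
      by (metis abs_cos_le_one abs_ge_self abs_mult abs_ge_zero mult_left_le order_trans)
    also have "\<dots> < C * cosh (k * u)"
      using SC cosh_real_ge_1[of "k * u"] C by (smt (verit) mult_le_cancel_left1)
    finally show ?thesis by simp
  qed
  have hyp: "cosh (k * u) * cosh (k * u) = sinh (k * u) * sinh (k * u) + 1" for u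
    using cosh_square_eq[of "k * u"] by (simp add: power2_eq_square)
  have trig: "sin (k * v) * sin (k * v) = 1 - cos (k * v) * cos (k * v)" for v
    using sin_cos_squared_add[of "k * v"] by (simp add: power2_eq_square)
  have kk: "k * k = C * C - S * S" using CS by (simp add: power2_eq_square)
  note dv = has_derivative_vector_3[THEN has_derivative_eq_rhs]
  note di = has_derivative_sinh_fst has_derivative_cosh_fst has_derivative_sin_snd has_derivative_cos_snd
    derivative_eq_intros refl
  show ?thesis
    apply (intro exI)
    apply (rule isothermic_frame_quotient[where
      \<gamma> = "k\<^sup>2" and D = "\<lambda>z. C * cosh (k * fst z) - S * cos (k * snd z)"
      and \<alpha> = "\<lambda>z. C * k * sinh (k * fst z)" and \<beta> = "\<lambda>z. S * k * sin (k * snd z)"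
      and E = "\<lambda>z. vector [C - S * cosh (k * fst z) * cos (k * snd z),
        - C * sinh (k * fst z) * sin (k * snd z),
        k * sinh (k * fst z) * cos (k * snd z)]"
      and F = "\<lambda>z. vector [S * sinh (k * fst z) * sin (k * snd z),
        S - C * cosh (k * fst z) * cos (k * snd z),
        - k * cosh (k * fst z) * sin (k * snd z)]"
      and G = "\<lambda>z. vector [k * sinh (k * fst z),
        k * sin (k * snd z),
        S * cosh (k * fst z) - C * cos (k * snd z)]"
      and Eu = "\<lambda>z. vector [- S * k * sinh (k * fst z) * cos (k * snd z),
        - C * k * cosh (k * fst z) * sin (k * snd z),
        k * k * cosh (k * fst z) * cos (k * snd z)]"
      and Ev = "\<lambda>z. vector [S * k * cosh (k * fst z) * sin (k * snd z),
        - C * k * sinh (k * fst z) * cos (k * snd z),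
        - k * k * sinh (k * fst z) * sin (k * snd z)]"
      and Fu = "\<lambda>z. vector [S * k * cosh (k * fst z) * sin (k * snd z),
        - C * k * sinh (k * fst z) * cos (k * snd z),
        - k * k * sinh (k * fst z) * sin (k * snd z)]"
      and Fv = "\<lambda>z. vector [S * k * sinh (k * fst z) * cos (k * snd z),
        C * k * cosh (k * fst z) * sin (k * snd z),
        - k * k * cosh (k * fst z) * cos (k * snd z)]"
      and Gu = "\<lambda>z. vector [k * k * cosh (k * fst z), 0, S * k * sinh (k * fst z)]"
      and Gv = "\<lambda>z. vector [0, k * k * cos (k * snd z), C * k * sin (k * snd z)]"])
    subgoal using k by simp
    subgoal by (rule D)
    subgoal by (rule di | simp add: fun_eq_iff algebra_simps)+
    subgoal unfolding hyperbolic_model_def case_prod_beta using k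
      by (intro dv) (rule di | simp add: vector_3_simps fun_eq_iff field_simps power2_eq_square power3_eq_cube)+
    subgoal by (intro dv) (rule di | simp add: vector_3_simps fun_eq_iff algebra_simps)+
    subgoal by (intro dv) (rule di | simp add: vector_3_simps fun_eq_iff algebra_simps)+
    subgoal by (intro dv) (rule di | simp add: vector_3_simps fun_eq_iff algebra_simps)+
    subgoal for z using hyp[of "fst z"] trig[of "snd z"] kk unfolding vector_3_simps by algebra
    subgoal for z using hyp[of "fst z"] trig[of "snd z"] kk unfolding vector_3_simps by algebra
    subgoal for z using hyp[of "fst z"] trig[of "snd z"] kk unfolding vector_3_simps by algebra
    subgoal for z using hyp[of "fst z"] trig[of "snd z"] kk unfolding vector_3_simps by algebra
    subgoal for z using hyp[of "fst z"] trig[of "snd z"] kk unfolding vector_3_simps by algebra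
    subgoal for z using hyp[of "fst z"] trig[of "snd z"] kk unfolding vector_3_simps by algebra
    subgoal for z unfolding vector_3_simps power2_eq_square by (intro conjI; (insert hyp[of "fst z"] trig[of "snd z"] kk, algebra | simp add: algebra_simps))
    subgoal for z unfolding vector_3_simps power2_eq_square by (intro conjI; (insert hyp[of "fst z"] trig[of "snd z"] kk, algebra | simp add: algebra_simps))
    subgoal for z unfolding vector_3_simps power2_eq_square by (intro conjI; (insert hyp[of "fst z"] trig[of "snd z"] kk, algebra | simp add: algebra_simps))
    subgoal for z unfolding vector_3_simps power2_eq_square by (intro conjI; (insert hyp[of "fst z"] trig[of "snd z"] kk, algebra | simp add: algebra_simps))
    subgoal for z unfolding vector_3_simps power2_eq_square by (intro conjI; (insert hyp[of "fst z"] trig[of "snd z"] kk, algebra | simp add: algebra_simps))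
    subgoal for z unfolding vector_3_simps power2_eq_square by (intro conjI; (insert hyp[of "fst z"] trig[of "snd z"] kk, algebra | simp add: algebra_simps))
    done
qed

text \<open>Here \<open>\<rho> = D / (2 \<surd>2)\<close> with \<open>D = 2 + u\<^sup>2 + v\<^sup>2\<close>, and the normal is found from
  \<open>E \<times> F = D G\<close> as for the hyperbolic models.\<close>

lemma enneper_frame:
  "\<exists>p q e f n. isothermic_frame UNIV
    (\<lambda>z. (2 + (fst z)\<^sup>2 + (snd z)\<^sup>2) / (2 * sqrt 2)) p q (model_surface (pi / 4)) e f n"
proof -
  note dv = has_derivative_vector_3[THEN has_derivative_eq_rhs]
  note di = derivative_eq_intros refl
  have s': "sqrt 2 * (sqrt 2 * x) = (2::real) * x" for x by (simp flip: mult.assoc)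
  have nonneg: "2 + x\<^sup>2 + y\<^sup>2 > (0::real)" for x y by (smt (verit) zero_le_power2)
  show ?thesis
    apply (intro exI)
    apply (rule isothermic_frame_quotient[where
      \<gamma> = "2 * sqrt 2" and D = "\<lambda>z. 2 + (fst z)\<^sup>2 + (snd z)\<^sup>2"
      and \<alpha> = "\<lambda>z. 2 * fst z" and \<beta> = "\<lambda>z. 2 * snd z"
      and E = "\<lambda>z. vector [2 - (fst z)\<^sup>2 + (snd z)\<^sup>2, - 2 * fst z * snd z, 2 * sqrt 2 * fst z]"
      and F = "\<lambda>z. vector [2 * fst z * snd z, - 2 - (fst z)\<^sup>2 + (snd z)\<^sup>2, - 2 * sqrt 2 * snd z]"
      and G = "\<lambda>z. vector [2 * sqrt 2 * fst z, 2 * sqrt 2 * snd z, (fst z)\<^sup>2 + (snd z)\<^sup>2 - 2]"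
      and Eu = "\<lambda>z. vector [- 2 * fst z, - 2 * snd z, 2 * sqrt 2]"
      and Ev = "\<lambda>z. vector [2 * snd z, - 2 * fst z, 0]"
      and Fu = "\<lambda>z. vector [2 * snd z, - 2 * fst z, 0]"
      and Fv = "\<lambda>z. vector [2 * fst z, 2 * snd z, - 2 * sqrt 2]"
      and Gu = "\<lambda>z. vector [2 * sqrt 2, 0, 2 * fst z]"
      and Gv = "\<lambda>z. vector [0, 2 * sqrt 2, 2 * snd z]"])
    subgoal by simp
    subgoal by (rule nonneg)
    subgoal by (rule di | simp add: fun_eq_iff algebra_simps)+
    subgoal unfolding model_surface_def case_prod_beta if_P[OF refl]
      by (intro dv) (rule di | simp add: vector_3_simps fun_eq_iff field_simps power2_eq_square s')+
    subgoal by (intro dv) (rule di | simp add: vector_3_simps fun_eq_iff algebra_simps)+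
    subgoal by (intro dv) (rule di | simp add: vector_3_simps fun_eq_iff algebra_simps)+
    subgoal by (intro dv) (rule di | simp add: vector_3_simps fun_eq_iff algebra_simps)+
    subgoal unfolding vector_3_simps by (simp add: algebra_simps power2_eq_square s')
    subgoal unfolding vector_3_simps by (simp add: algebra_simps power2_eq_square s')
    subgoal unfolding vector_3_simps by (simp add: algebra_simps power2_eq_square s')
    subgoal unfolding vector_3_simps by (simp add: algebra_simps power2_eq_square s')
    subgoal unfolding vector_3_simps by (simp add: algebra_simps power2_eq_square s')
    subgoal unfolding vector_3_simps by (simp add: algebra_simps power2_eq_square s')
    subgoal unfolding vector_3_simps by (simp add: algebra_simps power2_eq_square s')
    subgoal unfolding vector_3_simps by (simp add: algebra_simps power2_eq_square s')
    subgoal unfolding vector_3_simps by (simp add: algebra_simps power2_eq_square s')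
    subgoal unfolding vector_3_simps by (simp add: algebra_simps power2_eq_square s')
    subgoal unfolding vector_3_simps by (simp add: algebra_simps power2_eq_square s')
    subgoal unfolding vector_3_simps by (simp add: algebra_simps power2_eq_square s')
    done
qed

lemma sinh_of_real_mult: "sinh (of_real x * of_real y :: complex) = of_real (sinh (x * y))"
  and cosh_of_real_mult: "cosh (of_real x * of_real y :: complex) = of_real (cosh (x * y))"
  and sin_of_real_mult: "sin (of_real x * of_real y :: complex) = of_real (sin (x * y))"
  and cos_of_real_mult: "cos (of_real x * of_real y :: complex) = of_real (cos (x * y))"
  by (simp_all add: sinh_field_def cosh_field_def sin_of_real cos_of_real exp_of_real
      flip: of_real_mult of_real_minus)

lemma model_surface_hyperbolic:
  assumes "cos (2 * \<theta>) > 0"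
  shows "model_surface \<theta> = hyperbolic_model (sqrt (cos (2 * \<theta>))) (cos \<theta>) (sin \<theta>)"
proof -
  have "cos (2 * (pi / 4)) = (0::real)" by simp
  then have ne: "\<theta> \<noteq> pi / 4" using assms by (metis less_irrefl)
  define k where "k = sqrt (cos (2 * \<theta>))"
  have k: "model_k \<theta> = of_real k"
    using assms by (simp add: model_k_def csqrt_of_real k_def)
  have r: "model_1 \<theta> u v = of_real ((k * u * cos \<theta> - sin \<theta> * sinh (k * u) * cos (k * v)) / k ^ 3)"
    "model_2 \<theta> u v = of_real ((k * v * sin \<theta> - cos \<theta> * cosh (k * u) * sin (k * v)) / k ^ 3)"
    "model_3 \<theta> u v = of_real ((cosh (k * u) * cos (k * v) - 1) / k\<^sup>2)" for u v
    unfolding model_1_def model_2_def model_3_def Let_def k sinh_of_real_mult cosh_of_real_mult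
      cos_of_real_mult sin_of_real_mult by simp_all
  show ?thesis
    by (rule ext) (simp only: model_surface_def hyperbolic_model_def r ne if_False Re_complex_of_real
        k_def[symmetric] split: prod.splits)
qed

text \<open>For \<open>\<pi>/2 - \<theta>\<close> the constant \<open>k\<close> is replaced by \<open>\<i>k\<close>, which exchanges hyperbolic and
  trigonometric functions, while cosine and sine of the angle are exchanged as well. The factors
  \<open>\<i>\<close> cancel against those in \<open>(\<i>k)\<^sup>3\<close> and \<open>(\<i>k)\<^sup>2\<close> up to a sign.\<close>

lemma model_surface_swap:
  assumes "cos (2 * \<theta>) > 0"
  shows "model_surface \<theta> (u, v) =
    (let x = model_surface (pi / 2 - \<theta>) (v, u) in vector [- x $ 2, - x $ 1, - x $ 3])"
proof -
  define k where "k = sqrt (cos (2 * \<theta>))"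
  have k0: "k > 0" using assms by (simp add: k_def)
  have c: "cos (2 * (pi / 2 - \<theta>)) = - cos (2 * \<theta>)"
    by (simp add: cos_diff right_diff_distrib)
  have "cos (2 * (pi / 4)) = (0::real)" by simp
  then have "\<theta> \<noteq> pi / 4" using assms by (metis less_irrefl)
  then have ne: "pi / 2 - \<theta> \<noteq> pi / 4" by simp
  have k: "model_k (pi / 2 - \<theta>) = \<i> * of_real k"
    unfolding model_k_def c k_def using assms by simp
  have imag: "sinh (\<i> * y) = \<i> * sin y" "cosh (\<i> * y) = cos y"
    "sin (\<i> * y) = \<i> * sinh y" "cos (\<i> * y) = cosh y" for y
    by (simp_all add: sinh_conv_sin cosh_conv_cos)
  have sh: "sinh (\<i> * of_real k * of_real x) = \<i> * of_real (sin (k * x))"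
    and ch: "cosh (\<i> * of_real k * of_real x) = (of_real (cos (k * x)) :: complex)" 
    and si: "sin (\<i> * of_real k * of_real x) = \<i> * of_real (sinh (k * x))"
    and co: "cos (\<i> * of_real k * of_real x) = (of_real (cosh (k * x)) :: complex)" for x
    unfolding mult.assoc imag sinh_of_real_mult cosh_of_real_mult cos_of_real_mult sin_of_real_mult by simp_all
  have k3: "(\<i> * of_real k) ^ 3 = - \<i> * of_real (k ^ 3)" "(\<i> * of_real k) ^ 2 = - of_real (k ^ 2)"
    by (simp_all add: power_mult_distrib power3_eq_cube mult_ac)
  have sc: "cos (pi / 2 - \<theta>) = sin \<theta>" "sin (pi / 2 - \<theta>) = cos \<theta>"
    by (simp_all add: sin_diff cos_diff)
  have m: "Re (model_1 (pi / 2 - \<theta>) v u) = - ((k * v * sin \<theta> - cos \<theta> * cosh (k * u) * sin (k * v)) / k ^ 3)"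
    "Re (model_2 (pi / 2 - \<theta>) v u) = - ((k * u * cos \<theta> - sin \<theta> * sinh (k * u) * cos (k * v)) / k ^ 3)"
    "Re (model_3 (pi / 2 - \<theta>) v u) = - ((cosh (k * u) * cos (k * v) - 1) / k\<^sup>2)"
    unfolding model_1_def model_2_def model_3_def Let_def k sh ch si co k3 sc
    using k0 by (simp_all add: Re_divide field_simps power2_eq_square power3_eq_cube)
  show ?thesis
    unfolding model_surface_hyperbolic[OF assms] hyperbolic_model_def
    unfolding model_surface_def
    using ne by (simp add: Let_def m flip: k_def)
qed

section \<open>Solving for the conformal factor\<close>

text \<open>With \<open>\<kappa>\<^sup>2 = c\<close> and \<open>Q = \<rho>\<^sub>v\<^sub>v\<close> the system has the first integrals
  \<open>exp(-\<kappa>u) (P + \<kappa>p)\<close>, \<open>exp(\<kappa>u) (P - \<kappa>p)\<close> and, up to sign, the components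
  of the vector \<open>(Q, \<kappa>q)\<close> rotated through the angle \<open>-\<kappa>v\<close>. Hence \<open>P = E cosh(\<kappa>u + a)\<close> and
  \<open>Q = D cos(\<kappa>v + b)\<close>, and \<open>c \<rho> = P - Q\<close>. The Gauss equation becomes \<open>E\<^sup>2 - D\<^sup>2 = c\<close>.
  With \<open>\<mu>\<^sup>2 = E\<^sup>2 + D\<^sup>2\<close> the pair \<open>(E, D) / \<mu>\<close> is \<open>(cos \<theta>, sin \<theta>)\<close> for an angle with
  \<open>cos(2\<theta>) = c / \<mu>\<^sup>2\<close>, so that \<open>k = \<kappa> / \<mu>\<close>.\<close>

lemma profile_hyperbolic:
  assumes U: "open U" "connected U" "U \<noteq> {}" and prof: "profile_system U \<rho> p q P c" and c: "c > 0"
  shows "\<exists>\<theta> \<mu> a b. 0 \<le> \<theta> \<and> \<theta> < pi / 4 \<and> \<mu> > 0 \<and> (let k = sqrt (cos (2 * \<theta>)) in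
    \<forall>z\<in>U. \<rho> z = (cos \<theta> * cosh (k * (\<mu> * fst z + a)) - sin \<theta> * cos (k * (\<mu> * snd z + b))) / k\<^sup>2 / \<mu>)"
proof -
  obtain z0 where z0: "z0 \<in> U" using U(3) by blast
  define \<kappa> where "\<kappa> = sqrt c"
  have \<kappa>: "\<kappa> > 0" "\<kappa> * \<kappa> = c" using c by (auto simp: \<kappa>_def)
  have d\<rho>: "(\<rho> has_derivative (\<lambda>w. fst w * p z + snd w * q z)) (at z)"
    and dp: "(p has_derivative (\<lambda>w. fst w * P z)) (at z)"
    and dq: "(q has_derivative (\<lambda>w. snd w * (P z - c * \<rho> z))) (at z)"
    and dP: "(P has_derivative (\<lambda>w. fst w * (c * p z))) (at z)"
    and pos: "\<rho> z > 0"
    and gauss: "\<rho> z * (2 * P z - c * \<rho> z) - (p z)\<^sup>2 - (q z)\<^sup>2 = 1" if "z \<in> U" for z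
    using prof that unfolding profile_system_def by auto
  define Q where "Q z = P z - c * \<rho> z" for z
  have dQ: "(Q has_derivative (\<lambda>w. - snd w * (c * q z))) (at z)" if "z \<in> U" for z
    unfolding Q_def using dP[OF that] d\<rho>[OF that]
    by (auto intro!: derivative_eq_intros simp: fun_eq_iff algebra_simps)
  have dq': "(q has_derivative (\<lambda>w. snd w * Q z)) (at z)" if "z \<in> U" for z
    using dq[OF that] by (simp add: Q_def)
  have const: "h z = h z0" if "z \<in> U" "\<And>x. x \<in> U \<Longrightarrow> (h has_derivative (\<lambda>w. 0)) (at x)" for z and h :: "real \<times> real \<Rightarrow> real"
    using has_derivative_zero_unique_connected[OF U(1,2) that(2) that(1) z0] .
  define C1 where "C1 = exp (- \<kappa> * fst z0) * (P z0 + \<kappa> * p z0)"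
  define C2 where "C2 = exp (\<kappa> * fst z0) * (P z0 - \<kappa> * p z0)"
  define D1 where "D1 = Q z0 * cos (\<kappa> * snd z0) + \<kappa> * q z0 * sin (\<kappa> * snd z0)"
  define D2 where "D2 = Q z0 * sin (\<kappa> * snd z0) - \<kappa> * q z0 * cos (\<kappa> * snd z0)"
  have C1: "exp (- \<kappa> * fst z) * (P z + \<kappa> * p z) = C1" if "z \<in> U" for z
    unfolding C1_def
    by (rule const[of z "\<lambda>z. exp (- \<kappa> * fst z) * (P z + \<kappa> * p z)", OF that])
       (auto intro!: derivative_eq_intros dp dP simp: fun_eq_iff algebra_simps simp flip: \<kappa>(2))
  have C2: "exp (\<kappa> * fst z) * (P z - \<kappa> * p z) = C2" if "z \<in> U" for z
    unfolding C2_def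
    by (rule const[of z "\<lambda>z. exp (\<kappa> * fst z) * (P z - \<kappa> * p z)", OF that])
       (auto intro!: derivative_eq_intros dp dP simp: fun_eq_iff algebra_simps simp flip: \<kappa>(2))
  have D1: "Q z * cos (\<kappa> * snd z) + \<kappa> * q z * sin (\<kappa> * snd z) = D1" if "z \<in> U" for z
    unfolding D1_def
    by (rule const[of z "\<lambda>z. Q z * cos (\<kappa> * snd z) + \<kappa> * q z * sin (\<kappa> * snd z)", OF that])
       (auto intro!: derivative_eq_intros dq' dQ simp: fun_eq_iff algebra_simps simp flip: \<kappa>(2))
  have D2: "Q z * sin (\<kappa> * snd z) - \<kappa> * q z * cos (\<kappa> * snd z) = D2" if "z \<in> U" for z
    unfolding D2_def
    by (rule const[of z "\<lambda>z. Q z * sin (\<kappa> * snd z) - \<kappa> * q z * cos (\<kappa> * snd z)", OF that])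
       (auto intro!: derivative_eq_intros dq' dQ simp: fun_eq_iff algebra_simps simp flip: \<kappa>(2))
  have CC: "C1 * C2 = (P z0)\<^sup>2 - c * (p z0)\<^sup>2"
  proof -
    have "C1 * C2 = (exp (- \<kappa> * fst z0) * exp (\<kappa> * fst z0)) * ((P z0 + \<kappa> * p z0) * (P z0 - \<kappa> * p z0))"
      unfolding C1_def C2_def by (simp only: ac_simps)
    also have "\<dots> = (P z0 + \<kappa> * p z0) * (P z0 - \<kappa> * p z0)"
      by (simp flip: exp_add)
    finally show ?thesis unfolding \<kappa>(2)[symmetric] by (simp add: algebra_simps power2_eq_square)
  qed
  have DD: "D1\<^sup>2 + D2\<^sup>2 = (Q z0)\<^sup>2 + c * (q z0)\<^sup>2"
    unfolding D1_def D2_def using sin_cos_squared_add[of "\<kappa> * snd z0"] \<kappa>(2) by algebra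
  define E D where "E = sqrt (C1 * C2)" and "D = sqrt (D1\<^sup>2 + D2\<^sup>2)"
  have diff: "C1 * C2 - (D1\<^sup>2 + D2\<^sup>2) = c"
  proof -
    have "c * (\<rho> z0 * (2 * P z0 - c * \<rho> z0) - (p z0)\<^sup>2 - (q z0)\<^sup>2) = c"
      using gauss[OF z0] by simp
    then show ?thesis unfolding CC DD Q_def by (simp add: algebra_simps power2_eq_square)
  qed
  have CCpos: "C1 * C2 > 0" using diff c by (smt (verit) zero_le_power2)
  have E: "E > 0" "E\<^sup>2 = C1 * C2" and D: "D \<ge> 0" "D\<^sup>2 = D1\<^sup>2 + D2\<^sup>2"
    using CCpos by (auto simp: E_def D_def)
  \<comment> \<open>The sign of \<open>P\<close> is where positivity of \<open>\<rho>\<close> enters: \<open>P > Q\<close> and \<open>P\<^sup>2 > Q\<^sup>2\<close>. Since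
    \<open>C1 * C2 > 0\<close>, a positive \<open>P\<close> makes both constants positive.\<close>
  have P0: "P z0 > 0"
  proof (rule ccontr)
    assume "\<not> P z0 > 0"
    moreover have "Q z0 < P z0" using pos[OF z0] c by (simp add: Q_def)
    ultimately have "(P z0)\<^sup>2 \<le> (Q z0)\<^sup>2" by (simp add: abs_le_square_iff[symmetric])
    moreover have "(P z0)\<^sup>2 - c * (p z0)\<^sup>2 - ((Q z0)\<^sup>2 + c * (q z0)\<^sup>2) = c"
      using diff unfolding CC DD .
    ultimately show False using c by (smt (verit) mult_nonneg_nonneg zero_le_power2)
  qed
  have C1pos: "C1 > 0"
  proof -
    have "C1 * exp (\<kappa> * fst z0) + C2 * exp (- \<kappa> * fst z0) = 2 * P z0"
      unfolding C1_def C2_def by (simp add: exp_minus field_simps)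
    then have "C1 * exp (\<kappa> * fst z0) + C2 * exp (- \<kappa> * fst z0) > 0" using P0 by simp
    moreover have "C1 * exp (\<kappa> * fst z0) + C2 * exp (- \<kappa> * fst z0) < 0" if "C1 < 0" "C2 < 0"
      using that by (intro add_neg_neg mult_neg_pos) auto
    ultimately show ?thesis using CCpos by (auto simp: zero_less_mult_iff)
  qed
  then have C2pos: "C2 > 0" using CCpos by (simp add: zero_less_mult_iff)
  \<comment> \<open>The phase that turns \<open>C1 exp(\<kappa>u) + C2 exp(-\<kappa>u)\<close> into a multiple of \<open>cosh(\<kappa>u + a)\<close>.\<close>
  define a where "a = ln (C1 / E)"
  have ea: "exp a = C1 / E" "exp (- a) = C2 / E"
    using C1pos E by (simp_all add: a_def exp_minus field_simps power2_eq_square)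
  obtain b where b: "D1 = D * cos b" "D2 = - D * sin b"
  proof -
    have "Complex D1 (- D2) = rcis D (Arg (Complex D1 (- D2)))"
      using rcis_cmod_Arg[of "Complex D1 (- D2)"] by (simp add: D_def cmod_def)
    from arg_cong[OF this, of Re] arg_cong[OF this, of Im]
    show thesis by (intro that[of "Arg (Complex D1 (- D2))"]) simp_all
  qed
  have P: "P z = E * cosh (\<kappa> * fst z + a)" if z: "z \<in> U" for z
  proof -
    have "E * cosh (\<kappa> * fst z + a) = (C1 * exp (\<kappa> * fst z) + C2 * exp (- \<kappa> * fst z)) / 2"
      using E(1) unfolding cosh_field_def exp_add minus_add_distrib ea by (simp add: field_simps)
    also have "\<dots> = P z"
      unfolding C1[OF z, symmetric] C2[OF z, symmetric] by (simp add: exp_minus field_simps)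
    finally show ?thesis ..
  qed
  have Q: "Q z = D * cos (\<kappa> * snd z + b)" if z: "z \<in> U" for z
  proof -
    have "D * cos (\<kappa> * snd z + b) = D1 * cos (\<kappa> * snd z) + D2 * sin (\<kappa> * snd z)"
      unfolding b cos_add by (simp add: algebra_simps)
    also have "\<dots> = Q z"
      unfolding D1[OF z, symmetric] D2[OF z, symmetric]
      using sin_cos_squared_add[of "\<kappa> * snd z"] by algebra
    finally show ?thesis ..
  qed
  define \<mu> where "\<mu> = sqrt (E\<^sup>2 + D\<^sup>2)"
  have \<mu>: "\<mu> > 0" "\<mu>\<^sup>2 = E\<^sup>2 + D\<^sup>2" using E(1) by (auto simp: \<mu>_def add_pos_nonneg)
  have "(E / \<mu>)\<^sup>2 + (D / \<mu>)\<^sup>2 = 1"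
    using \<mu> E(1) by (simp add: power_divide flip: add_divide_distrib)
  then obtain \<theta> where \<theta>: "0 \<le> \<theta>" "\<theta> \<le> pi / 2" "E / \<mu> = cos \<theta>" "D / \<mu> = sin \<theta>"
    using sincos_total_pi_half[of "E / \<mu>" "D / \<mu>"] E D \<mu> by auto
  have cos2: "cos (2 * \<theta>) = c / \<mu>\<^sup>2"
    using diff E D unfolding cos_double \<theta>(3,4)[symmetric] by (simp add: power_divide flip: diff_divide_distrib)
  then have "cos (2 * \<theta>) > 0" using c \<mu>(1) by simp
  have "\<theta> < pi / 4"
  proof (rule ccontr)
    assume "\<not> \<theta> < pi / 4"
    then have "cos (2 * \<theta>) \<le> cos (pi / 2)" using \<theta>(1,2) by (intro cos_monotone_0_pi_le) auto
    then show False using \<open>cos (2 * \<theta>) > 0\<close> by simp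
  qed
  define k where "k = sqrt (cos (2 * \<theta>))"
  have k: "k = \<kappa> / \<mu>" using \<mu>(1) by (simp add: k_def cos2 real_sqrt_divide \<kappa>_def)
  have "\<rho> z = (cos \<theta> * cosh (k * (\<mu> * fst z + a / k)) - sin \<theta> * cos (k * (\<mu> * snd z + b / k))) / k\<^sup>2 / \<mu>"
    if z: "z \<in> U" for z
  proof -
    have "k * (\<mu> * fst z + a / k) = \<kappa> * fst z + a" "k * (\<mu> * snd z + b / k) = \<kappa> * snd z + b"
      using k \<mu>(1) \<kappa>(1) by (simp_all add: distrib_left)
    moreover have "k\<^sup>2 = c / \<mu>\<^sup>2" using k \<kappa>(2) by (simp add: power_divide power2_eq_square)
    moreover have "c * \<rho> z = P z - Q z" by (simp add: Q_def)
    ultimately show ?thesis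
      using c \<mu>(1) unfolding \<theta>(3,4)[symmetric] by (simp add: P[OF z] Q[OF z] field_simps power2_eq_square)
  qed
  then show ?thesis
    using \<theta>(1) \<open>\<theta> < pi / 4\<close> \<mu>(1) unfolding k_def Let_def by blast
qed

text \<open>Now \<open>P\<close> is a constant \<open>m\<close>, and \<open>p - m u\<close> and \<open>q - m v\<close> are constant. The Gauss equation, which
  is linear in \<open>\<rho>\<close>, then gives \<open>2 m \<rho> = 1 + p\<^sup>2 + q\<^sup>2\<close>. The scale \<open>\<mu> = \<surd>2 m\<close> makes the new
  parameters equal to \<open>\<surd>2 p\<close> and \<open>\<surd>2 q\<close>.\<close>

lemma profile_parabolic:
  assumes U: "open U" "connected U" "U \<noteq> {}" and prof: "profile_system U \<rho> p q P 0"
  shows "\<exists>\<mu> a b. \<mu> > 0 \<and>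
    (\<forall>z\<in>U. \<rho> z = (2 + (\<mu> * fst z + a)\<^sup>2 + (\<mu> * snd z + b)\<^sup>2) / (2 * sqrt 2) / \<mu>)"
proof -
  obtain z0 where z0: "z0 \<in> U" using U(3) by blast
  have dp: "(p has_derivative (\<lambda>w. fst w * P z)) (at z)"
    and dq: "(q has_derivative (\<lambda>w. snd w * P z)) (at z)"
    and dP: "(P has_derivative (\<lambda>w. 0)) (at z)"
    and pos: "\<rho> z > 0"
    and gauss: "\<rho> z * (2 * P z) - (p z)\<^sup>2 - (q z)\<^sup>2 = 1" if "z \<in> U" for z
    using prof that unfolding profile_system_def by auto
  have const: "h z = h z0" if "z \<in> U" "\<And>x. x \<in> U \<Longrightarrow> (h has_derivative (\<lambda>w. 0)) (at x)" for z and h :: "real \<times> real \<Rightarrow> real"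
    using has_derivative_zero_unique_connected[OF U(1,2) that(2) that(1) z0] .
  define m where "m = P z0"
  have P: "P z = m" if "z \<in> U" for z
    unfolding m_def by (rule const[OF that dP])
  have p: "p z - m * fst z = p z0 - m * fst z0" if "z \<in> U" for z
    by (rule const[of z "\<lambda>z. p z - m * fst z", OF that])
       (auto intro!: derivative_eq_intros dp simp: P)
  have q: "q z - m * snd z = q z0 - m * snd z0" if "z \<in> U" for z
    by (rule const[of z "\<lambda>z. q z - m * snd z", OF that])
       (auto intro!: derivative_eq_intros dq simp: P)
  have m: "m > 0"
  proof -
    have "\<rho> z0 * (2 * m) > 0" using gauss[OF z0] unfolding m_def by (smt (verit) zero_le_power2)
    then show ?thesis using pos[OF z0] by (simp add: zero_less_mult_iff)
  qed
  have "\<rho> z = (2 + (sqrt 2 * m * fst z + sqrt 2 * (p z0 - m * fst z0))\<^sup>2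
      + (sqrt 2 * m * snd z + sqrt 2 * (q z0 - m * snd z0))\<^sup>2) / (2 * sqrt 2) / (sqrt 2 * m)" if z: "z \<in> U" for z
  proof -
    have "sqrt 2 * m * fst z + sqrt 2 * (p z0 - m * fst z0) = sqrt 2 * p z"
      "sqrt 2 * m * snd z + sqrt 2 * (q z0 - m * snd z0) = sqrt 2 * q z"
      unfolding p[OF z, symmetric] q[OF z, symmetric] by (simp_all add: algebra_simps)
    moreover have "\<rho> z * (2 * m) = 1 + (p z)\<^sup>2 + (q z)\<^sup>2" using gauss[OF z] P[OF z] by simp
    moreover have "2 * sqrt 2 * (sqrt 2 * m) = 4 * m" by (simp flip: mult.assoc)
    ultimately show ?thesis using m by (simp add: power_mult_distrib field_simps)
  qed
  then show ?thesis using m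
    by (intro exI[of _ "sqrt 2 * m"] exI[of _ "sqrt 2 * (p z0 - m * fst z0)"] exI[of _ "sqrt 2 * (q z0 - m * snd z0)"]) simp
qed

section \<open>Classification\<close>

lemma congruent_to_rescaled_model:
  fixes \<mu> a b :: real
  assumes U: "open U" "connected U" and X: "isothermic_frame U \<rho> p q X e f n"
    and M: "isothermic_frame UNIV \<rho>' p' q' M e' f' n'" and \<mu>: "\<mu> > 0"
    and \<rho>: "\<And>z. z \<in> U \<Longrightarrow> \<rho> z = \<rho>' (\<mu> * fst z + a, \<mu> * snd z + b) / \<mu>"
  shows "\<exists>T. isometry_of_space T \<and>
    (\<forall>z\<in>U. X z = T ((1 / \<mu>\<^sup>2) *\<^sub>R M (\<mu> * fst z + a, \<mu> * snd z + b)))"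
  by (rule isothermic_frame_rigidity[OF U X isothermic_frame_subset[OF isothermic_frame_rescale[OF M \<mu>] subset_UNIV] \<rho>])

lemma hyperbolic_classification:
  assumes U: "open U" "connected U" "U \<noteq> {}" and X: "isothermic_frame U \<rho> p q X e f n"
    and prof: "profile_system U \<rho> p q P c" and c: "c > 0"
  shows "\<exists>\<theta> T \<mu> a b. 0 \<le> \<theta> \<and> \<theta> < pi / 4 \<and> isometry_of_space T \<and> \<mu> > 0 \<and>
    (\<forall>z\<in>U. X z = T ((1 / \<mu>\<^sup>2) *\<^sub>R model_surface \<theta> (\<mu> * fst z + a, \<mu> * snd z + b)))"
proof -
  obtain \<theta> \<mu> a b where \<theta>: "0 \<le> \<theta>" "\<theta> < pi / 4" and \<mu>: "\<mu> > 0"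
    and \<rho>: "\<And>z. z \<in> U \<Longrightarrow> \<rho> z = (cos \<theta> * cosh (sqrt (cos (2 * \<theta>)) * (\<mu> * fst z + a))
        - sin \<theta> * cos (sqrt (cos (2 * \<theta>)) * (\<mu> * snd z + b))) / (sqrt (cos (2 * \<theta>)))\<^sup>2 / \<mu>"
    using profile_hyperbolic[OF U prof c] unfolding Let_def by blast
  have c2: "cos (2 * \<theta>) > 0" and c1: "cos \<theta> > 0"
    using \<theta> by (auto intro!: cos_gt_zero_pi)
  have "(cos \<theta>)\<^sup>2 - (sin \<theta>)\<^sup>2 = (sqrt (cos (2 * \<theta>)))\<^sup>2"
    using c2 by (simp add: cos_double)
  from hyperbolic_model_frame[OF _ c1 this] obtain p' q' e' f' n' where
    "isothermic_frame UNIV (\<lambda>z. (cos \<theta> * cosh (sqrt (cos (2 * \<theta>)) * fst z)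
        - sin \<theta> * cos (sqrt (cos (2 * \<theta>)) * snd z)) / (sqrt (cos (2 * \<theta>)))\<^sup>2) p' q'
      (model_surface \<theta>) e' f' n'"
    using c2 unfolding model_surface_hyperbolic[OF c2] by auto
  from congruent_to_rescaled_model[OF U(1,2) X this \<mu>, of a b] \<rho> obtain T where
    "isometry_of_space T" "\<forall>z\<in>U. X z = T ((1 / \<mu>\<^sup>2) *\<^sub>R model_surface \<theta> (\<mu> * fst z + a, \<mu> * snd z + b))"
    by auto
  then show ?thesis using \<theta> \<mu> by blast
qed

text \<open>The exchange turns \<open>\<rho>\<^sub>u\<^sub>u - \<rho>\<^sub>v\<^sub>v\<close> into its negative.\<close>

lemma profile_system_swap:
  assumes "profile_system U \<rho> p q P c"
  shows "profile_system (prod.swap ` U) (\<rho> \<circ> prod.swap) (q \<circ> prod.swap) (p \<circ> prod.swap)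
    (\<lambda>z. P (prod.swap z) - c * \<rho> (prod.swap z)) (- c)"
  unfolding profile_system_def
proof (rule ballI, goal_cases)
  case (1 z)
  then obtain u v where uv: "(u, v) \<in> U" and z: "z = (v, u)" by auto
  note c = has_derivative_comp_swap[where u = u and v = v, folded z]
  note F = assms[unfolded profile_system_def, rule_format, OF uv]
  have "((\<lambda>x. P (prod.swap x) - c * \<rho> (prod.swap x)) has_derivative
      (\<lambda>w. fst (prod.swap w) * (c * p (u, v)) - c * (fst (prod.swap w) * p (u, v) + snd (prod.swap w) * q (u, v)))) (at z)"
    by (rule has_derivative_diff[OF c has_derivative_mult_right[OF c]]) (use F in auto)
  then have 1: "((\<lambda>x. P (prod.swap x) - c * \<rho> (prod.swap x)) has_derivative
      (\<lambda>w. fst w * (- c * (q \<circ> prod.swap) z))) (at z)"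
    by (rule has_derivative_eq_rhs) (simp add: z fun_eq_iff algebra_simps)
  have 2: "((\<rho> \<circ> prod.swap) has_derivative (\<lambda>w. fst w * (q \<circ> prod.swap) z + snd w * (p \<circ> prod.swap) z)) (at z)"
    unfolding o_def by (rule has_derivative_eq_rhs[OF c]) (use F z in \<open>auto simp: add.commute\<close>)
  have 3: "((q \<circ> prod.swap) has_derivative (\<lambda>w. fst w * (P (prod.swap z) - c * \<rho> (prod.swap z)))) (at z)"
    unfolding o_def by (rule has_derivative_eq_rhs[OF c]) (use F z in auto)
  have 4: "((p \<circ> prod.swap) has_derivative (\<lambda>w. snd w * (P (prod.swap z) - c * \<rho> (prod.swap z) - - c * (\<rho> \<circ> prod.swap) z))) (at z)"
    unfolding o_def by (rule has_derivative_eq_rhs[OF c]) (use F z in auto)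
  have 5: "(\<rho> \<circ> prod.swap) z > 0" "(\<rho> \<circ> prod.swap) z * (2 * (P (prod.swap z) - c * \<rho> (prod.swap z)) - - c * (\<rho> \<circ> prod.swap) z)
      - ((q \<circ> prod.swap) z)\<^sup>2 - ((p \<circ> prod.swap) z)\<^sup>2 = 1"
    using F by (simp_all add: z algebra_simps)
  show ?case
    using 1 2 3 4 5 by (intro conjI)
qed

lemma swap_image: "open (prod.swap ` U)" "connected (prod.swap ` U)"
  if "open U" "connected U" for U :: "(real \<times> real) set"
proof -
  have c: "continuous_on A prod.swap" for A :: "(real \<times> real) set"
    unfolding prod.swap_def by (intro continuous_intros)
  have "prod.swap ` U = prod.swap -` U" by force
  then show "open (prod.swap ` U)" using open_vimage[OF that(1) c] by simp
  show "connected (prod.swap ` U)" using that(2) c by (rule connected_continuous_image[rotated])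
qed

lemma frame_classification:
  assumes U: "open U" "connected U" "U \<noteq> {}" and X: "isothermic_frame U \<rho> p q X e f n"
    and prof: "profile_system U \<rho> p q P c"
  shows "\<exists>\<theta>\<in>{- pi / 4 <..< 3 * pi / 4}. \<exists>T \<mu> a b. isometry_of_space T \<and> \<mu> > 0 \<and>
    (\<forall>z\<in>U. X z = T ((1 / \<mu>\<^sup>2) *\<^sub>R model_surface \<theta> (\<mu> * fst z + a, \<mu> * snd z + b)))"
proof -
  consider "c > 0" | "c = 0" | "c < 0" by linarith
  then show ?thesis
  proof cases
    case 1
    from hyperbolic_classification[OF U X prof this] obtain \<theta> T \<mu> a b where
      *: "0 \<le> \<theta>" "\<theta> < pi / 4" "isometry_of_space T" "\<mu> > 0"
      "\<forall>z\<in>U. X z = T ((1 / \<mu>\<^sup>2) *\<^sub>R model_surface \<theta> (\<mu> * fst z + a, \<mu> * snd z + b))"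
      by blast
    have "- pi / 4 < \<theta>" "\<theta> < 3 * pi / 4" using *(1,2) pi_gt_zero by linarith+
    then show ?thesis using *(3-5) by (intro bexI[of _ \<theta>] exI[of _ T] exI[of _ \<mu>] exI[of _ a] exI[of _ b]) auto
  next
    case 2
    obtain \<mu> a b where \<mu>: "\<mu> > 0" and
      \<rho>: "\<And>z. z \<in> U \<Longrightarrow> \<rho> z = (2 + (\<mu> * fst z + a)\<^sup>2 + (\<mu> * snd z + b)\<^sup>2) / (2 * sqrt 2) / \<mu>"
      using profile_parabolic[OF U prof[unfolded 2]] by blast
    obtain p' q' e' f' n' where "isothermic_frame UNIV
        (\<lambda>z. (2 + (fst z)\<^sup>2 + (snd z)\<^sup>2) / (2 * sqrt 2)) p' q' (model_surface (pi / 4)) e' f' n'"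
      using enneper_frame by blast
    from congruent_to_rescaled_model[OF U(1,2) X this \<mu>, of a b] \<rho> obtain T where
      "isometry_of_space T" "\<forall>z\<in>U. X z = T ((1 / \<mu>\<^sup>2) *\<^sub>R model_surface (pi / 4) (\<mu> * fst z + a, \<mu> * snd z + b))"
      by auto
    then show ?thesis using \<mu> pi_gt_zero
      by (intro bexI[of _ "pi / 4"] exI[of _ T] exI[of _ \<mu>] exI[of _ a] exI[of _ b]) auto
  next
    case 3
    then have "- c > 0" by simp
    from hyperbolic_classification[OF swap_image[OF U(1,2)] _ isothermic_frame_swap[OF X]
        profile_system_swap[OF prof] this] U(3)
    obtain \<theta> T \<mu> a b where
      *: "0 \<le> \<theta>" "\<theta> < pi / 4" "isometry_of_space T" "\<mu> > 0"
      "\<forall>z\<in>prod.swap ` U. (X \<circ> prod.swap) z = T ((1 / \<mu>\<^sup>2) *\<^sub>R model_surface \<theta> (\<mu> * fst z + a, \<mu> * snd z + b))"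
      by blast
    \<comment> \<open>The orthogonal map that relates the two models in \<open>model_surface_swap\<close>.\<close>
    define J :: "real^3 \<Rightarrow> real^3" where "J x = vector [- x $ 2, - x $ 1, - x $ 3]" for x
    have J: "J (x - y) = J x - J y" "J (r *\<^sub>R x) = r *\<^sub>R J x" "norm (J x) = norm x" for x y r
      by (simp_all add: J_def vec_eq_iff forall_3 norm_eq_sqrt_inner inner_vec_def sum_3)
    have "isometry_of_space (T \<circ> J)"
      using *(3) unfolding isometry_of_space_def o_def by (simp add: dist_norm J flip: J(1))
    moreover have "X z = (T \<circ> J) ((1 / \<mu>\<^sup>2) *\<^sub>R model_surface (pi / 2 - \<theta>) (\<mu> * fst z + b, \<mu> * snd z + a))"
      if "z \<in> U" for z
    proof -
      have c2: "cos (2 * \<theta>) > 0" using *(1,2) by (intro cos_gt_zero_pi) auto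
      have "X z = T ((1 / \<mu>\<^sup>2) *\<^sub>R model_surface \<theta> (\<mu> * snd z + a, \<mu> * fst z + b))"
        using *(5)[rule_format, of "prod.swap z"] that by auto
      then show ?thesis
        unfolding model_surface_swap[OF c2] Let_def by (simp add: J flip: J_def)
    qed
    moreover have "- pi / 4 < pi / 2 - \<theta>" "pi / 2 - \<theta> < 3 * pi / 4"
      using *(1,2) pi_gt_zero by linarith+
    ultimately show ?thesis using *(4)
      by (intro bexI[of _ "pi / 2 - \<theta>"] exI[of _ "T \<circ> J"] exI[of _ \<mu>] exI[of _ b] exI[of _ a]) auto
  qed
qed

theorem proposition2p4:
  fixes U :: "(real \<times> real) set"
    and X N :: "real \<times> real \<Rightarrow> real^3"
  assumes "open U" and "U \<noteq> {}" and "simply_connected U"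
    and "conformal_immersion_on U X"
    and "unit_normal_on U X N"
    and "minimal_on U X N"
    and "\<not> in_some_plane (X ` U)"
    and "\<forall>p\<in>U. \<not> umbilic X N p"
    and "curvature_line_coordinates_on U X N"
    and "\<forall>p\<in>U. hopf_factor X N p = - 1 / 2"
    and "planar_curvature_lines_on U X N"
  shows "\<exists>\<theta>\<in>{- pi / 4 <..< 3 * pi / 4}. \<exists>T r \<phi>.
           isometry_of_space T \<and> r > 0 \<and> isothermic_reparametrization \<phi> \<and>
           (\<forall>p\<in>U. X p = T (r *\<^sub>R model_surface \<theta> (\<phi> p)))"
proof -
  interpret isothermic_minimal_surface U X N
    using assms by unfold_locales auto
  have con: "connected U" using assms(3) by (rule simply_connected_imp_connected)
  obtain c where "profile_system U \<rho> p q P c"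
    using exists_profile_system[OF assms(11) con] .
  from frame_classification[OF assms(1) con assms(2) adapted_frame this]
  obtain \<theta> T \<mu> a b where *: "\<theta> \<in> {- pi / 4 <..< 3 * pi / 4}" "isometry_of_space T" "\<mu> > 0"
    "\<forall>z\<in>U. X z = T ((1 / \<mu>\<^sup>2) *\<^sub>R model_surface \<theta> (\<mu> * fst z + a, \<mu> * snd z + b))"
    by blast
  have "isothermic_reparametrization (\<lambda>z. (\<mu> * fst z + a, \<mu> * snd z + b))"
    unfolding isothermic_reparametrization_def using *(3)
    by (intro exI[of _ \<mu>] exI[of _ 1] exI[of _ 1] exI[of _ a] exI[of _ b]) auto
  then show ?thesis
    using * by (intro bexI[OF _ *(1)] exI[of _ T] exI[of _ "1 / \<mu>\<^sup>2"]
        exI[of _ "\<lambda>z. (\<mu> * fst z + a, \<mu> * snd z + b)"]) auto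
qed

end
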